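(* Let $Q$ be a fixed credal Markov kernel on $\mathcal X$ satisfying almost-sure conditional coverage, i.e. $p_0(x)\in Q(x)$ for $P_X$-almost every $x$, and let $X_1,\dots,X_n$ be drawn independently from $P_X$. Suppose that $\mathcal F_\Delta\neq\varnothing$ and that there are constants $B,L<\infty$ and one common measurable set $\mathcal X_0\subseteq\mathcal X$ with $P_X(\mathcal X_0)=1$ such that for all $x\in\mathcal X_0$, all $\theta\in\boldsymbol\Theta$, both heads $f\in\{f_{-,\theta},f_{+,\theta}\}$ and all $q\in Q(x)$, $$0\le \ell(f(x),q)\le B,\qquad \max_k[-\log f_k(x)]-\min_k[-\log f_k(x)]\le L .$$ Let $\eta_n\ge 0$ and let $\widehat\theta_n\in\boldsymbol\Theta$ (depending on $X_1,\dots,X_n$) satisfy $\widehat J_{Q,n}(\widehat\theta_n)\le\inf_{\theta\in\boldsymbol\Theta}\widehat J_{Q,n}(\theta)+\eta_n$; put $\widehat{\bar f}_n=(f_{-,\widehat\theta_n}+f_{+,\widehat\theta_n})/2$. Then for every $\delta\in(0,1)$, with probability at least $1-\delta$, $$R_0(\widehat{\bar f}_n)-\inf_{f\in\mathcal F_\Delta}R_0(f)\le 4\,\mathfrak R_n(\mathcal J_Q)+2B\sqrt{\frac{\log(2/\delta)}{2n}}+\eta_n+L\,\mathbb E[d_Q(X)],$$ where $X\sim P_X$.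
   Context: $\mathcal X$ is a Polish space with its Borel $\sigma$-algebra, $\mathcal Y=\{1,\dots,K\}$, and $\Delta^{K-1}=\{q\in\mathbb R_{\ge0}^K:\sum_k q_k=1\}$. $P_0$ is a probability distribution on $\mathcal X\times\mathcal Y$ with input marginal $P_X$ and conditional label distribution $p_0(x)=P_0(Y=\cdot\mid X=x)\in\Delta^{K-1}$. A credal Markov kernel is a measurable set-valued map $Q:\mathcal X\rightrightarrows\Delta^{K-1}$ (its graph $\{(x,q):q\in Q(x)\}$ is measurable in the product $\sigma$-algebra) such that $Q(x)$ is non-empty, closed and convex for every $x$. The loss is cross-entropy: $\ell(p,q)=-\sum_{k=1}^K q_k\log p_k$ for $p,q\in\Delta^{K-1}$. The true risk of a predictor $f:\mathcal X\to\Delta^{K-1}$ is $R_0(f)=\mathbb E_{X\sim P_X}[\ell(f(X),p_0(X))]$. The two-head model class is a family, indexed by $\theta$ in an arbitrary parameter set $\boldsymbol\Theta$, of pairs of measurable predictors $f_{-,\theta},f_{+,\theta}:\mathcal X\to\Delta^{K-1}$, fixed (as is $Q$) independently of the sample. Define $$j_\theta(x)=\tfrac12\Big(\max_{q\in Q(x)}\ell(f_{-,\theta}(x),q)+\min_{q\in Q(x)}\ell(f_{+,\theta}(x),q)\Big),\quad \widehat J_{Q,n}(\theta)=\frac1n\sum_{i=1}^n j_\theta(X_i),\quad \mathcal J_Q=\{j_\theta:\theta\in\boldsymbol\Theta\}.$$ The comparison class is $\mathcal F_\Delta=\{f:\exists\,\theta_f\in\boldsymbol\Theta\text{ with }f_{-,\theta_f}=f_{+,\theta_f}=f\}$.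 The total-variation diameter is $d_Q(x)=\sup_{q,r\in Q(x)}\tfrac12\|q-r\|_1$. The expected absolute Rademacher complexity of a class $\mathcal G$ of real functions is $\mathfrak R_n(\mathcal G)=\mathbb E_{X_{1:n},\sigma_{1:n}}\big[\sup_{g\in\mathcal G}\big|\frac1n\sum_{i=1}^n\sigma_i g(X_i)\big|\big]$, with $X_i$ i.i.d. from $P_X$ and $\sigma_i$ independent uniform $\pm1$ signs independent of the $X_i$. It is assumed that the suprema over $\boldsymbol\Theta$ (equivalently over $\mathcal J_Q$) that arise are measurable and that $\mathfrak R_n(\mathcal J_Q)$ is well defined. *)

theory Defs
  imports "HOL-Probability.Probability"
begin

text \<open>
  The label set \<open>{1..K}\<close> is a finite type \<open>'k\<close>, with \<open>K = CARD('k)\<close>.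
\<close>

definition prob_simplex :: "(real ^ 'k::finite) set" where
  "prob_simplex = {q. (\<forall>k. 0 \<le> q $ k) \<and> (\<Sum>k\<in>UNIV. q $ k) = 1}"

text \<open>
  Since \<open>ln 0 = 0\<close> in the library, \<open>- log 0 = \<infinity>\<close> has to be put in by hand. In \<^typ>\<open>ereal\<close>
  we have \<open>0 * \<infinity> = 0\<close>, so a label of probability zero contributes nothing to the loss.
\<close>

definition neg_log :: "real \<Rightarrow> ereal" where
  "neg_log t = (if t = 0 then \<infinity> else ereal (- ln t))"

definition cross_entropy :: "real ^ 'k::finite \<Rightarrow> real ^ 'k \<Rightarrow> ereal" where
  "cross_entropy p q = (\<Sum>k\<in>UNIV. ereal (q $ k) * neg_log (p $ k))"

text \<open>
  Expectation of a nonnegative extended-real function. It is only applied to nonnegative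
  functions, so the truncation in \<^const>\<open>e2ennreal\<close> has no effect. The library's nonnegative
  integral also gives the right value when the function is only known to be measurable for the
  completion of \<open>M\<close>, so no measurability is built into the definition.
\<close>

definition expect :: "'a measure \<Rightarrow> ('a \<Rightarrow> ereal) \<Rightarrow> ereal" where
  "expect M g = enn2ereal (\<integral>\<^sup>+ x. e2ennreal (g x) \<partial>M)"

definition input_marginal :: "('a::polish_space \<times> 'k::finite) measure \<Rightarrow> 'a measure" where
  "input_marginal P0 = distr P0 borel fst"

text \<open>\<open>p0\<close> is a version of the regular conditional distribution of the label given the input.\<close>

definition cond_label_dist ::
    "('a::polish_space \<times> 'k::finite) measure \<Rightarrow> ('a \<Rightarrow> real ^ 'k) \<Rightarrow> bool" where
  "cond_label_dist P0 p0 \<longleftrightarrow>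
     p0 \<in> borel_measurable borel \<and> (\<forall>x. p0 x \<in> prob_simplex) \<and>
     (\<forall>A\<in>sets borel. \<forall>k.
        emeasure P0 (A \<times> {k}) = (\<integral>\<^sup>+ x\<in>A. ennreal (p0 x $ k) \<partial>input_marginal P0))"

definition credal_kernel :: "('a::polish_space \<Rightarrow> (real ^ 'k::finite) set) \<Rightarrow> bool" where
  "credal_kernel Q \<longleftrightarrow>
     {(x, q). q \<in> Q x} \<in> sets (borel \<Otimes>\<^sub>M borel) \<and>
     (\<forall>x. Q x \<subseteq> prob_simplex \<and> Q x \<noteq> {} \<and> closed (Q x) \<and> convex (Q x))"

definition predictor :: "('a::polish_space \<Rightarrow> real ^ 'k::finite) \<Rightarrow> bool" where
  "predictor f \<longleftrightarrow> f \<in> borel_measurable borel \<and> (\<forall>x. f x \<in> prob_simplex)"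

definition true_risk ::
    "('a::polish_space \<times> 'k::finite) measure \<Rightarrow> ('a \<Rightarrow> real ^ 'k) \<Rightarrow> ('a \<Rightarrow> real ^ 'k) \<Rightarrow> ereal" where
  "true_risk P0 p0 f = expect (input_marginal P0) (\<lambda>x. cross_entropy (f x) (p0 x))"

text \<open>
  The maximum and the minimum over the compact set \<open>Q x\<close> are attained in the extended reals:
  \<open>cross_entropy p\<close> is lower semicontinuous on the simplex, and it is either continuous on
  \<open>Q x\<close> or takes the value \<open>\<infinity>\<close> there.
\<close>

definition two_head_loss ::
    "('a \<Rightarrow> (real ^ 'k::finite) set) \<Rightarrow> ('p \<Rightarrow> 'a \<Rightarrow> real ^ 'k) \<Rightarrow> ('p \<Rightarrow> 'a \<Rightarrow> real ^ 'k)
      \<Rightarrow> 'p \<Rightarrow> 'a \<Rightarrow> ereal" where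
  "two_head_loss Q fm fp \<theta> x =
     ((SUP q\<in>Q x. cross_entropy (fm \<theta> x) q) + (INF q\<in>Q x. cross_entropy (fp \<theta> x) q)) / 2"

definition loss_class ::
    "('a \<Rightarrow> (real ^ 'k::finite) set) \<Rightarrow> 'p set \<Rightarrow> ('p \<Rightarrow> 'a \<Rightarrow> real ^ 'k) \<Rightarrow> ('p \<Rightarrow> 'a \<Rightarrow> real ^ 'k)
      \<Rightarrow> ('a \<Rightarrow> ereal) set" where
  "loss_class Q \<Theta> fm fp = {two_head_loss Q fm fp \<theta> | \<theta>. \<theta> \<in> \<Theta>}"

text \<open>A sample of size \<open>n\<close> is a function on the index set \<open>{1..n}\<close>.\<close>

definition empirical_mean :: "nat \<Rightarrow> ('a \<Rightarrow> ereal) \<Rightarrow> (nat \<Rightarrow> 'a) \<Rightarrow> ereal" where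
  "empirical_mean n g x = (\<Sum>i=1..n. g (x i)) / ereal (real n)"

definition empirical_objective ::
    "('a \<Rightarrow> (real ^ 'k::finite) set) \<Rightarrow> ('p \<Rightarrow> 'a \<Rightarrow> real ^ 'k) \<Rightarrow> ('p \<Rightarrow> 'a \<Rightarrow> real ^ 'k)
      \<Rightarrow> nat \<Rightarrow> (nat \<Rightarrow> 'a) \<Rightarrow> 'p \<Rightarrow> ereal" where
  "empirical_objective Q fm fp n x \<theta> = empirical_mean n (two_head_loss Q fm fp \<theta>) x"

definition diagonal_class ::
    "'p set \<Rightarrow> ('p \<Rightarrow> 'a \<Rightarrow> real ^ 'k::finite) \<Rightarrow> ('p \<Rightarrow> 'a \<Rightarrow> real ^ 'k) \<Rightarrow> ('a \<Rightarrow> real ^ 'k) set" where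
  "diagonal_class \<Theta> fm fp = {f. \<exists>\<theta>\<in>\<Theta>. fm \<theta> = f \<and> fp \<theta> = f}"

definition mean_head ::
    "('p \<Rightarrow> 'a \<Rightarrow> real ^ 'k::finite) \<Rightarrow> ('p \<Rightarrow> 'a \<Rightarrow> real ^ 'k) \<Rightarrow> 'p \<Rightarrow> 'a \<Rightarrow> real ^ 'k" where
  "mean_head fm fp \<theta> x = (1 / 2) *\<^sub>R (fm \<theta> x + fp \<theta> x)"

definition tv_diameter :: "('a \<Rightarrow> (real ^ 'k::finite) set) \<Rightarrow> 'a \<Rightarrow> real" where
  "tv_diameter Q x = (SUP (q, r)\<in>Q x \<times> Q x. (1 / 2) * (\<Sum>k\<in>UNIV. \<bar>q $ k - r $ k\<bar>))"

text \<open>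
  Rademacher complexity. Functions may take infinite values, because the losses
  are only known to be finite on a set of full measure; points outside that set do not affect
  the expectation.
\<close>

definition rademacher_space :: "'a measure \<Rightarrow> nat \<Rightarrow> ((nat \<Rightarrow> 'a) \<times> (nat \<Rightarrow> real)) measure" where
  "rademacher_space P n =
     (\<Pi>\<^sub>M i\<in>{1..n}. P) \<Otimes>\<^sub>M (\<Pi>\<^sub>M i\<in>{1..n}. uniform_count_measure {-1, 1})"

definition rademacher_sup ::
    "nat \<Rightarrow> ('a \<Rightarrow> ereal) set \<Rightarrow> (nat \<Rightarrow> 'a) \<times> (nat \<Rightarrow> real) \<Rightarrow> ereal" where
  "rademacher_sup n G = (\<lambda>(x, \<sigma>). SUP g\<in>G. \<bar>(\<Sum>i=1..n. ereal (\<sigma> i) * g (x i)) / ereal (real n)\<bar>)"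

definition rademacher_complexity :: "'a measure \<Rightarrow> nat \<Rightarrow> ('a \<Rightarrow> ereal) set \<Rightarrow> ereal" where
  "rademacher_complexity P n G = expect (rademacher_space P n) (rademacher_sup n G)"

definition uniform_deviation :: "'a measure \<Rightarrow> nat \<Rightarrow> ('a \<Rightarrow> ereal) set \<Rightarrow> (nat \<Rightarrow> 'a) \<Rightarrow> ereal" where
  "uniform_deviation P n G x = (SUP g\<in>G. \<bar>empirical_mean n g x - expect P g\<bar>)"

end

theory Submission
  imports Defs
begin

text \<open>
  By convexity of \<open>- ln\<close> the risk of the averaged predictor is at most the mean of the risks of the
  two heads. On the coverage event replacing \<open>p0 x\<close> by another point of \<open>Q x\<close> changes a cross entropy
  by at most \<open>L\<close> times the total variation diameter, so this mean exceeds the two-head loss by at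
  most \<open>L / 2\<close> times that diameter, and conversely for the losses of diagonal parameters. The
  excess risk is thus controlled by twice the uniform deviation of the two-head losses, which is
  bounded by McDiarmid's inequality and symmetrization.

  Two points need care. The two-head loss is a supremum over the uncountable set \<open>Q x\<close>, so its
  measurability (for the completion of the input law) rests on the measurable projection theorem.
  And the ghost-sample supremum of the usual symmetrization argument need not be measurable; it
  is avoided by mixing the coordinates of the sample and the ghost sample for each fixed vector
  of signs separately, which only involves sections of the Rademacher supremum.
\<close>

text \<open>Up to a null set, the event of probability \<open>1 - \<delta>\<close> is cut out by the
  uniform deviation alone. On it the comparison is deterministic, so nothing has to be known about
  how \<open>\<theta>hat\<close> depends on the sample. Write \<open>D\<close> for the deviation
  bound, twice the Rademacher complexity plus \<open>B * sqrt (ln (2 / \<delta>) / (2 * n))\<close>,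
  and \<open>d\<close> for the expected diameter. The risk of the averaged head is at most the
  expected loss of the selected parameter plus \<open>L / 2 * d\<close>; passing to the empirical
  objective costs \<open>D\<close>, near-minimality \<open>\<eta>\<close>, returning to the
  expectation at a diagonal parameter another \<open>D\<close>, and going on to its true risk
  another \<open>L / 2 * d\<close>. Hence the constants 4, 2 and 1. The diameter is charged with a
  half each time because maximum and minimum err in opposite directions: in either comparison one of
  the two heads is bounded with no error. In the projection theorem compactness does the work. All
  \<open>Q x\<close> lie in the compact simplex, so only the auxiliary sequence of naturals has to
  be confined to a compact set.\<close>

section \<open>Measurable projection\<close>

text \<open>These are the analytic sets. The class is closed under countable unions and intersections, which
  is why all Borel sets belong to it.\<close>

definition closed_projection :: "'z::metric_space set \<Rightarrow> bool" where
  "closed_projection A \<longleftrightarrow> (\<exists>C :: ('z \<times> (nat \<Rightarrow> nat)) set. closed C \<and> A = fst ` C)"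

lemma closed_imp_closed_projection:
  assumes "closed A" shows "closed_projection A"
  unfolding closed_projection_def
  by (rule exI[of _ "A \<times> UNIV"]) (use assms in \<open>auto intro: closed_Times simp: image_iff\<close>)

text \<open>Entry 0 of the auxiliary sequence names the member \<open>n\<close> of the union, and
  the shifted rest is a witness for \<open>A n\<close>. Selecting \<open>n\<close> by a coordinate
  is an open condition because the naturals are discrete, which keeps the coded set closed.\<close>

lemma closed_projection_UN:
  fixes A :: "nat \<Rightarrow> 'z::metric_space set"
  assumes "\<And>n. closed_projection (A n)"
  shows "closed_projection (\<Union>n. A n)"
proof -
  obtain C where C: "\<And>n. closed (C n)" "\<And>n. A n = fst ` (C n :: ('z \<times> (nat \<Rightarrow> nat)) set)"
    using assms unfolding closed_projection_def by metis
  define D where "D = {p :: 'z \<times> (nat \<Rightarrow> nat). (fst p, \<lambda>m. snd p (Suc m)) \<in> C (snd p 0)}"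
  have eq: "- D = (\<Union>n. (\<lambda>p. snd p 0) -` {n} \<inter> (\<lambda>p. (fst p, \<lambda>m. snd p (Suc m))) -` (- C n))"
    by (auto simp: D_def)
  have coord: "continuous_on UNIV (\<lambda>p::'z \<times> (nat \<Rightarrow> nat). snd p m)" for m
    by (rule continuous_on_product_then_coordinatewise) (rule continuous_on_snd[OF continuous_on_id])
  have "open ((\<lambda>p::'z \<times> (nat \<Rightarrow> nat). snd p 0) -` {n})" for n
    by (rule open_vimage[OF Topological_Spaces.open_discrete coord])
  moreover have "open ((\<lambda>p::'z \<times> (nat \<Rightarrow> nat). (fst p, \<lambda>m. snd p (Suc m))) -` (- C n))" for n
    
    by (intro open_vimage continuous_on_Pair continuous_on_fst continuous_on_id
        continuous_on_coordinatewise_then_product coord) (simp add: C(1) open_Compl)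
  ultimately have "closed D"
    unfolding closed_def eq by (intro open_UN ballI open_Int)
  moreover have "(\<Union>n. A n) = fst ` D"
  proof (intro set_eqI iffI)
    fix z assume "z \<in> (\<Union>n. A n)"
    then obtain n w where "(z, w) \<in> C n" using C(2) by auto
    then have "(z, case_nat n w) \<in> D" by (simp add: D_def)
    then show "z \<in> fst ` D" by force
  next
    fix z assume "z \<in> fst ` D"
    then show "z \<in> (\<Union>n. A n)" using C(2) by (force simp: D_def)
  qed
  ultimately show ?thesis unfolding closed_projection_def by blast
qed

text \<open>Countably many witness sequences, one for each \<open>A n\<close>, are interleaved into
  a single one through the pairing \<open>prod_encode\<close>; each membership is then a closed
  condition on the coded sequence.\<close>

lemma closed_projection_INT:
  fixes A :: "nat \<Rightarrow> 'z::metric_space set"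
  assumes "\<And>n. closed_projection (A n)"
  shows "closed_projection (\<Inter>n. A n)"
proof -
  obtain C where C: "\<And>n. closed (C n)" "\<And>n. A n = fst ` (C n :: ('z \<times> (nat \<Rightarrow> nat)) set)"
    using assms unfolding closed_projection_def by metis
  define D where "D = (\<Inter>n. (\<lambda>p :: 'z \<times> (nat \<Rightarrow> nat). (fst p, \<lambda>m. snd p (prod_encode (n, m)))) -` C n)"
  have coord: "continuous_on UNIV (\<lambda>p::'z \<times> (nat \<Rightarrow> nat). snd p m)" for m
    by (rule continuous_on_product_then_coordinatewise) (rule continuous_on_snd[OF continuous_on_id])
  have "closed D"
    unfolding D_def by (intro closed_INT ballI closed_vimage C continuous_on_Pair continuous_on_fst
        continuous_on_id continuous_on_coordinatewise_then_product coord)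
  moreover have "(\<Inter>n. A n) = fst ` D"
  proof (intro set_eqI iffI)
    fix z assume "z \<in> (\<Inter>n. A n)"
    then have "\<forall>n. \<exists>w. (z, w) \<in> C n" using C(2) by force
    then obtain w where w: "\<And>n. (z, w n) \<in> C n" by metis
    have "(z, \<lambda>k. case prod_decode k of (n, m) \<Rightarrow> w n m) \<in> D"
      using w by (simp add: D_def)
    then show "z \<in> fst ` D" by force
  next
    fix z assume "z \<in> fst ` D"
    then show "z \<in> (\<Inter>n. A n)" using C(2) by (force simp: D_def)
  qed
  ultimately show ?thesis unfolding closed_projection_def by blast
qed

text \<open>Open sets of a metric space are countable unions of closed sets: \<open>F n\<close>
  collects the points at distance at least \<open>inverse (Suc n)\<close> from the
  complement.\<close>

lemma open_imp_closed_projection: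
  fixes A :: "'z::metric_space set"
  assumes "open A" shows "closed_projection A"
proof -
  define F where "F n = (\<Inter>y\<in>-A. {x. inverse (Suc n) \<le> dist x y})" for n
  have "closed (F n)" for n
    unfolding F_def by (intro closed_INT ballI closed_Collect_le continuous_intros)
  moreover have "A = (\<Union>n. F n)"
  proof (intro set_eqI iffI)
    fix x assume "x \<in> A"
    then obtain e where e: "e > 0" "ball x e \<subseteq> A" using assms open_contains_ball by blast
    obtain n where "inverse (Suc n) < e" using reals_Archimedean e(1) by blast
    with e(2) have "x \<in> F n" by (force simp: F_def)
    then show "x \<in> (\<Union>n. F n)" by blast
  next
    fix x assume "x \<in> (\<Union>n. F n)"
    then obtain n where n: "x \<in> F n" by blast
    show "x \<in> A"
    proof (rule ccontr)
      assume "x \<notin> A"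
      then have "inverse (real (Suc n)) \<le> dist x x" using n unfolding F_def by blast
      then show False by (simp add: field_simps)
    qed
  qed
  ultimately show ?thesis
    using closed_projection_UN[of F] closed_imp_closed_projection by metis
qed

text \<open>Projections of closed sets need not be stable under complements, so the induction over
  the generated sigma-algebra carries the claim for a set and its complement together; unions and
  intersections then swap roles.\<close>

lemma borel_imp_closed_projection:
  fixes A :: "'z::metric_space set"
  assumes "A \<in> sets borel" shows "closed_projection A"
proof -
  have "A \<in> sigma_sets UNIV (Collect open)"
    using assms by (simp add: borel_def)
  then have "closed_projection A \<and> closed_projection (- A)"
  proof induction
    case (Basic a)
    then show ?case
      by (simp add: open_imp_closed_projection closed_imp_closed_projection closed_Compl)
  next
    case Empty
    then show ?case by (simp add: closed_imp_closed_projection)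
  next
    case (Compl a)
    then show ?case by (simp add: Compl_eq_Diff_UNIV[symmetric])
  next
    case (Union a)
    then show ?case
      by (auto simp: Compl_UN intro!: closed_projection_UN closed_projection_INT)
  qed
  then show ?thesis ..
qed

text \<open>Tychonoff for a product of finite sets. The space of all sequences of naturals is not
  even locally compact, so compactness has to come from a bound on every coordinate.\<close>

lemma compact_bounded_sequences: "compact {w :: nat \<Rightarrow> nat. \<forall>i. w i \<le> k i}"
proof -
  have "compactin (product_topology (\<lambda>i. euclidean) UNIV) (\<Pi>\<^sub>E i\<in>UNIV. {..k i})"
    by (subst compactin_PiE) (auto intro: finite_imp_compact)
  moreover have "(\<Pi>\<^sub>E i\<in>UNIV. {..k i}) = {w. \<forall>i. w i \<le> k i}" by (auto simp: PiE_def Pi_def)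
  ultimately show ?thesis by (simp add: euclidean_product_topology)
qed

text \<open>The bounds \<open>k i\<close> on the coordinates of the auxiliary sequence are chosen one at a time, by continuity
  from below of the outer measure; compactness then makes the intersection of the closures of the
  approximating projections a subset of the full projection.\<close>

lemma outer_approx_projection:
  fixes M :: "'a::metric_space measure" and C :: "(('a \<times> 'b::metric_space) \<times> (nat \<Rightarrow> nat)) set"
  assumes M: "finite_measure M" "sets M = sets borel"
    and C: "closed C" "fst ` C \<subseteq> UNIV \<times> T" and T: "compact T"
    and r: "r < outer_measure_of M (fst ` fst ` C)"
  shows "\<exists>F\<in>sets M. F \<subseteq> fst ` fst ` C \<and> r \<le> emeasure M F"
proof -
  interpret finite_measure M by fact
  have [simp]: "space M = UNIV" using sets_eq_imp_space_eq[OF M(2)] by simp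
  \<comment> \<open>\<open>D k m\<close> imposes the bounds \<open>k\<close> on the first
    \<open>m\<close> entries only. For \<open>m = 0\<close> it is the whole projection, and a newly
    imposed bound is lifted again by letting it grow.\<close>
  define D where "D k m = {x. \<exists>y w. ((x, y), w) \<in> C \<and> (\<forall>i<m. w i \<le> k i)}" for k m
  have D_cong: "D k m = D k' m" if "\<And>i. i < m \<Longrightarrow> k i = k' i" for k k' :: "nat \<Rightarrow> nat" and m
    using that by (auto simp: D_def)
  have step: "\<exists>j. r < outer_measure_of M (D (k(m := j)) (Suc m))"
    if "r < outer_measure_of M (D k m)" for k m
  proof -
    \<comment> \<open>Outer measure is continuous along increasing sequences of arbitrary sets, so
      the unknown measurability of the sets \<open>D\<close> does no harm.\<close>
    have "(SUP j. outer_measure_of M (D (k(m := j)) (Suc m))) = outer_measure_of M (\<Union>j. D (k(m := j)) (Suc m))"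
    proof (rule SUP_outer_measure_of_incseq)
      show "incseq (\<lambda>j. D (k(m := j)) (Suc m))"
      proof (intro incseq_SucI subsetI)
        fix j x assume "x \<in> D (k(m := j)) (Suc m)"
        then obtain y w where "((x, y), w) \<in> C" and w: "\<And>i. i < Suc m \<Longrightarrow> w i \<le> (k(m := j)) i"
          unfolding D_def by blast
        moreover have "w i \<le> (k(m := Suc j)) i" if "i < Suc m" for i
          using w[OF that] by (cases "i = m") auto
        ultimately show "x \<in> D (k(m := Suc j)) (Suc m)" unfolding D_def by blast
      qed
    qed simp
    also have "(\<Union>j. D (k(m := j)) (Suc m)) = D k m"
    proof (intro set_eqI iffI)
      fix x assume "x \<in> D k m"
      then obtain y w where "((x, y), w) \<in> C" "\<And>i. i < m \<Longrightarrow> w i \<le> k i"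
        unfolding D_def by blast
      then have "x \<in> D (k(m := w m)) (Suc m)" by (auto simp: D_def less_Suc_eq)
      then show "x \<in> (\<Union>j. D (k(m := j)) (Suc m))" by blast
    next
      fix x assume "x \<in> (\<Union>j. D (k(m := j)) (Suc m))"
      then obtain j y w where "((x, y), w) \<in> C" and w: "\<And>i. i < Suc m \<Longrightarrow> w i \<le> (k(m := j)) i"
        unfolding D_def by blast
      moreover have "w i \<le> k i" if "i < m" for i
        using w[of i] that by simp
      ultimately show "x \<in> D k m" unfolding D_def by blast
    qed
    finally have eq: "(SUP j. outer_measure_of M (D (k(m := j)) (Suc m))) = outer_measure_of M (D k m)" .
    show ?thesis using that unfolding eq[symmetric] less_SUP_iff by blast
  qed
  have "\<exists>ks. \<forall>m. r < outer_measure_of M (D (ks m) m) \<and> (\<exists>j. ks (Suc m) = (ks m)(m := j))"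
  proof (rule dependent_nat_choice)
    have "D (\<lambda>_. 0) 0 = fst ` fst ` C"
    proof (intro set_eqI iffI)
      fix x assume "x \<in> D (\<lambda>_. 0) 0"
      then obtain y w where "((x, y), w) \<in> C" unfolding D_def by blast
      from imageI[OF imageI[OF this]] show "x \<in> fst ` fst ` C" by (metis fst_conv)
    next
      fix x assume "x \<in> fst ` fst ` C"
      then obtain y w where "((x, y), w) \<in> C" by auto
      then show "x \<in> D (\<lambda>_. 0) 0" unfolding D_def by blast
    qed
    with r show "\<exists>k. r < outer_measure_of M (D k 0)" by metis
  next
    fix k m assume "r < outer_measure_of M (D k m)"
    from step[OF this] show "\<exists>k'. r < outer_measure_of M (D k' (Suc m)) \<and> (\<exists>j. k' = k(m := j))"
      by blast
  qed
  then obtain ks where ks: "\<And>m. r < outer_measure_of M (D (ks m) m)"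
    "\<And>m. \<exists>j. ks (Suc m) = (ks m)(m := j)" by metis
  \<comment> \<open>Stage \<open>m\<close> changes only bound \<open>m\<close>, so bound
    \<open>i\<close> is final from stage \<open>Suc i\<close> on; the diagonal collects the final
    values.\<close>
  define k where "k i = ks (Suc i) i" for i
  have stable: "i < m \<Longrightarrow> ks m i = k i" for i m
  proof (induction m)
    case (Suc m)
    then show ?case using ks(2)[of m] by (cases "i = m") (auto simp: k_def)
  qed simp
  have rD: "r < outer_measure_of M (D k m)" for m
    using ks(1)[of m] D_cong[of m "ks m" k] stable by simp
  define F where "F = (\<Inter>m. closure (D k m))"
  have dec: "decseq (\<lambda>m. closure (D k m))"
  proof (intro decseq_SucI closure_mono)
    fix m show "D k (Suc m) \<subseteq> D k m"
      unfolding D_def less_Suc_eq by blast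
  qed
  have cl: "closure (D k m) \<in> sets M" for m by (simp add: M(2))
  have "r \<le> emeasure M (closure (D k m))" for m
    using rD[of m] outer_measure_of_mono[OF closure_subset, of M "D k m"]
    unfolding outer_measure_of_eq[OF cl] by simp
  then have "r \<le> (INF m. emeasure M (closure (D k m)))" by (rule INF_greatest)
  also have "\<dots> = emeasure M F"
    unfolding F_def by (rule INF_emeasure_decseq) (use cl dec in auto)
  finally have "r \<le> emeasure M F" .
  moreover have "F \<in> sets M" unfolding F_def by (intro sets.countable_INT) (use cl in auto)
  moreover have "F \<subseteq> fst ` fst ` C"
  proof
    fix x assume "x \<in> F"
    have "\<forall>m. \<exists>p. p \<in> C \<and> (\<forall>i<m. snd p i \<le> k i) \<and> dist (fst (fst p)) x < inverse (Suc m)"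
    proof
      fix m
      have "x \<in> closure (D k m)" using \<open>x \<in> F\<close> by (simp add: F_def)
      moreover have "0 < inverse (real (Suc m))" by simp
      ultimately obtain x' where "x' \<in> D k m" "dist x' x < inverse (Suc m)"
        unfolding closure_approachable by blast
      then obtain y w where "((x', y), w) \<in> C" "\<forall>i<m. w i \<le> k i" unfolding D_def by blast
      with \<open>dist x' x < _\<close> show "\<exists>p. p \<in> C \<and> (\<forall>i<m. snd p i \<le> k i) \<and> dist (fst (fst p)) x < inverse (Suc m)"
        by (intro exI[of _ "((x', y), w)"]) simp
    qed
    from choice[OF this] obtain p where p: "\<And>m. p m \<in> C" "\<And>m i. i < m \<Longrightarrow> snd (p m) i \<le> k i"
      "\<And>m. dist (fst (fst (p m))) x < inverse (Suc m)" by blast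
    define xs ys ws where "xs m = fst (fst (p m))" and "ys m = snd (fst (p m))" and "ws m = snd (p m)" for m
    have seq: "\<And>m. ((xs m, ys m), ws m) \<in> C" "\<And>m i. i < m \<Longrightarrow> ws m i \<le> k i"
      "\<And>m. dist (xs m) x < inverse (Suc m)"
      using p by (simp_all add: xs_def ys_def ws_def)
    \<comment> \<open>The bound \<open>k i\<close> applies to \<open>ws m i\<close> only for
      \<open>i < m\<close>; the finitely many sequences with \<open>m \<le> i\<close> are taken into
      the maximum.\<close>
    define k' where "k' i = Max (insert (k i) ((\<lambda>m. ws m i) ` {..i}))" for i
    have ws: "ws m \<in> {w. \<forall>i. w i \<le> k' i}" for m
    proof safe
      fix i show "ws m i \<le> k' i"
      proof (cases "i < m")
        case True
        then have "ws m i \<le> k i" by (rule seq)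
        also have "\<dots> \<le> k' i" by (simp add: k'_def)
        finally show ?thesis .
      next
      case False
      then show ?thesis unfolding k'_def by (intro Max_ge) auto
      qed
    qed
    have ysT: "ys m \<in> T" for m using seq(1)[of m] C(2) by force
    have "seq_compact (T \<times> {w :: nat \<Rightarrow> nat. \<forall>i. w i \<le> k' i})"
      by (intro compact_imp_seq_compact compact_Times T compact_bounded_sequences)
    moreover have "\<forall>m. (ys m, ws m) \<in> T \<times> {w. \<forall>i. w i \<le> k' i}" using ws ysT by simp
    ultimately obtain l s where s: "strict_mono s" "((\<lambda>m. (ys m, ws m)) \<circ> s) \<longlonglongrightarrow> l"
      by (rule seq_compactE)
    have "(\<lambda>m. dist (xs m) x) \<longlonglongrightarrow> 0"
      by (rule LIMSEQ_norm_0) (use seq(3) in \<open>simp add: inverse_eq_divide\<close>)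
    then have "xs \<longlonglongrightarrow> x" by (simp add: tendsto_dist_iff[of xs])
    then have xs: "(\<lambda>m. xs (s m)) \<longlonglongrightarrow> x" using LIMSEQ_subseq_LIMSEQ[OF _ s(1)] by (simp add: comp_def)
    have "(\<lambda>m. ys (s m)) \<longlonglongrightarrow> fst l" "(\<lambda>m. ws (s m)) \<longlonglongrightarrow> snd l"
      using tendsto_fst[OF s(2)] tendsto_snd[OF s(2)] by (simp_all add: comp_def)
    then have "(\<lambda>m. ((xs (s m), ys (s m)), ws (s m))) \<longlonglongrightarrow> ((x, fst l), snd l)"
      by (intro tendsto_Pair xs)
    then have "((x, fst l), snd l) \<in> C"
      by (rule closed_sequentially[OF C(1) seq(1)])
    then show "x \<in> fst ` fst ` C" by (metis fst_conv imageI)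
  qed
  ultimately show ?thesis by blast
qed

text \<open>A measurable cover \<open>E\<close> from outside and a countable union \<open>F\<close>
  of measurable subsets from inside have the same finite measure, so the projection differs from
  \<open>F\<close> by a subset of a null set.\<close>

theorem measurable_projection:
  fixes M :: "'a::metric_space measure" and G :: "('a \<times> 'b::metric_space) set"
  assumes M: "finite_measure M" "sets M = sets borel"
    and G: "G \<in> sets borel" "G \<subseteq> UNIV \<times> T" and T: "compact T"
  shows "fst ` G \<in> sets (completion M)"
proof -
  interpret finite_measure M by fact
  have sp[simp]: "space M = UNIV" using sets_eq_imp_space_eq[OF M(2)] by simp
  obtain C :: "(('a \<times> 'b) \<times> (nat \<Rightarrow> nat)) set" where C: "closed C" "G = fst ` C"
    using borel_imp_closed_projection[OF G(1)] unfolding closed_projection_def by blast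
  let ?A = "fst ` G"
  obtain E where E: "E \<in> sets M" "?A \<subseteq> E" "outer_measure_of M ?A = emeasure M E"
    using outer_measure_of_attain[of ?A M] by auto
  obtain S where S: "\<And>n::nat. S n \<in> sets M" "\<And>n. S n \<subseteq> ?A"
      "\<And>n. emeasure M E - ennreal (inverse (Suc n)) \<le> emeasure M (S n)"
  proof -
    have "\<exists>F\<in>sets M. F \<subseteq> ?A \<and> emeasure M E - ennreal (inverse (Suc n)) \<le> emeasure M F" for n
    \<comment> \<open>The approximation from inside asks for a strict inequality, which fails for a
      null cover; there the empty set serves.\<close>
    proof (cases "emeasure M E = 0")
      case False
      then have "emeasure M E - ennreal (inverse (Suc n)) < outer_measure_of M ?A"
        unfolding E(3) by (intro ennreal_between) (auto simp: less_top[symmetric] zero_less_iff_neq_zero)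
      then show ?thesis
        using outer_approx_projection[OF M C(1) _ T] C(2) G(2) by metis
    qed auto
    then show ?thesis using that by metis
  qed
  define F where "F = (\<Union>n. S n)"
  have F: "F \<in> sets M" "F \<subseteq> ?A" using S(1,2) by (auto simp: F_def)
  have "emeasure M E \<le> emeasure M F"
  proof (rule ennreal_le_epsilon)
    fix e :: real assume "e > 0"
    then obtain n where n: "inverse (Suc n) < e" using reals_Archimedean by blast
    have "emeasure M E \<le> emeasure M (S n) + ennreal (inverse (Suc n))"
      using S(3)[of n] by (simp add: ennreal_minus_le_iff add.commute)
    also have "\<dots> \<le> emeasure M F + ennreal e"
      using n S(1) by (intro add_mono emeasure_mono ennreal_leI) (auto simp: F_def)
    finally show "emeasure M E \<le> emeasure M F + ennreal e" .
  qed
  then have "emeasure M (E - F) = 0"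
    using E F by (subst emeasure_Diff) (auto simp: diff_eq_0_iff_ennreal less_top[symmetric])
  then have "E - F \<in> null_sets M" using E F by (auto simp: null_sets_def)
  moreover have "?A = F \<union> (?A - F)" "?A - F \<subseteq> E - F" using F E by auto
  ultimately show ?thesis using F(1) by (metis sets_completionI)
qed

section \<open>Suprema and infima over a measurable family of subsets of a compact set\<close>

lemma sets_completion_Bex:
  fixes Q :: "'a::{metric_space, second_countable_topology} \<Rightarrow> 'b::{metric_space, second_countable_topology} set"
  assumes M: "finite_measure M" "sets M = sets borel"
    and Q: "{(x, q). q \<in> Q x} \<in> sets (borel \<Otimes>\<^sub>M borel)" "\<And>x. Q x \<subseteq> T" "compact T"
    and P: "{(x, q). P x q} \<in> sets (borel \<Otimes>\<^sub>M borel)"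
  shows "{x. \<exists>q\<in>Q x. P x q} \<in> sets (completion M)"
proof -
  let ?G = "{(x, q). q \<in> Q x} \<inter> {(x, q). P x q}"
  have "{x. \<exists>q\<in>Q x. P x q} = fst ` ?G"
    by force
  also have "\<dots> \<in> sets (completion M)"
  proof (rule measurable_projection[OF M _ _ Q(3)])
    \<comment> \<open>Second countability identifies the product sigma-algebra with the Borel sets
      of the product, to which the projection theorem applies.\<close>
    show "?G \<in> sets borel"
      using sets.Int[OF Q(1) P] unfolding borel_prod .
    show "?G \<subseteq> UNIV \<times> T" using Q(2) by auto
  qed
  finally show ?thesis .
qed

text \<open>A supremum exceeds \<open>c\<close> exactly when some member does, so strict superlevel
  sets are existential statements and hence projections. For this reason measurability is tested on
  strict inequalities.\<close>

lemma measurable_completion_SUP: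
  fixes Q :: "'a::{metric_space, second_countable_topology} \<Rightarrow> 'b::{metric_space, second_countable_topology} set"
    and h :: "'a \<Rightarrow> 'b \<Rightarrow> ereal"
  assumes M: "finite_measure M" "sets M = sets borel"
    and Q: "{(x, q). q \<in> Q x} \<in> sets (borel \<Otimes>\<^sub>M borel)" "\<And>x. Q x \<subseteq> T" "compact T"
    and h[measurable]: "(\<lambda>(x, q). h x q) \<in> borel_measurable (borel \<Otimes>\<^sub>M borel)"
  shows "(\<lambda>x. SUP q\<in>Q x. h x q) \<in> borel_measurable (completion M)"
proof (rule borel_measurableI_greater)
  fix c
  have "{p \<in> space (borel \<Otimes>\<^sub>M borel). c < (\<lambda>(x, q). h x q) p} \<in> sets (borel \<Otimes>\<^sub>M borel)"
    by measurable
  then have "{(x, q). c < h x q} \<in> sets (borel \<Otimes>\<^sub>M borel)"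
    by (simp add: space_pair_measure case_prod_unfold)
  from sets_completion_Bex[OF M Q this]
  show "{x \<in> space (completion M). c < (SUP q\<in>Q x. h x q)} \<in> sets (completion M)"
    using sets_eq_imp_space_eq[OF M(2)] by (simp add: less_SUP_iff)
qed

lemma measurable_completion_INF:
  fixes Q :: "'a::{metric_space, second_countable_topology} \<Rightarrow> 'b::{metric_space, second_countable_topology} set"
    and h :: "'a \<Rightarrow> 'b \<Rightarrow> ereal"
  assumes M: "finite_measure M" "sets M = sets borel"
    and Q: "{(x, q). q \<in> Q x} \<in> sets (borel \<Otimes>\<^sub>M borel)" "\<And>x. Q x \<subseteq> T" "compact T"
    and h[measurable]: "(\<lambda>(x, q). h x q) \<in> borel_measurable (borel \<Otimes>\<^sub>M borel)"
  shows "(\<lambda>x. INF q\<in>Q x. h x q) \<in> borel_measurable (completion M)"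
proof (rule borel_measurableI_less)
  fix c
  have "{p \<in> space (borel \<Otimes>\<^sub>M borel). (\<lambda>(x, q). h x q) p < c} \<in> sets (borel \<Otimes>\<^sub>M borel)"
    by measurable
  then have "{(x, q). h x q < c} \<in> sets (borel \<Otimes>\<^sub>M borel)"
    by (simp add: space_pair_measure case_prod_unfold)
  from sets_completion_Bex[OF M Q this]
  show "{x \<in> space (completion M). (INF q\<in>Q x. h x q) < c} \<in> sets (completion M)"
    using sets_eq_imp_space_eq[OF M(2)] by (simp add: INF_less_iff)
qed

section \<open>McDiarmid's inequality\<close>

text \<open>Hoeffding's lemma wants an interval containing the values, while the bound is to depend
  on the oscillation \<open>c\<close> only; the interval of length \<open>c\<close> starting at the
  infimum will do.\<close>

lemma Hoeffding_oscillation: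
  assumes "prob_space P" and f[measurable]: "f \<in> borel_measurable P"
    and bd: "\<And>y. y \<in> space P \<Longrightarrow> \<bar>f y\<bar> \<le> K"
    and osc: "\<And>y y'. y \<in> space P \<Longrightarrow> y' \<in> space P \<Longrightarrow> \<bar>f y - f y'\<bar> \<le> c"
    and l: "l > (0::real)"
  shows "(\<integral>\<^sup>+ y. ennreal (exp (l * (f y - (\<integral>y. f y \<partial>P)))) \<partial>P) \<le> ennreal (exp (l\<^sup>2 * c\<^sup>2 / 8))"
proof -
  interpret prob_space P by fact
  define a where "a = Inf (f ` space P)"
  have bb: "bdd_below (f ` space P)"
    by (rule bdd_belowI2[of _ "- K"]) (use bd in force)
  have "f y \<in> {a..a + c}" if y: "y \<in> space P" for y
  proof -
    have "a \<le> f y" unfolding a_def by (rule cInf_lower[OF imageI[OF y] bb])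
    moreover have "f y - c \<le> a"
      unfolding a_def
    proof (rule cINF_greatest)
      fix y' assume "y' \<in> space P"
      then show "f y - c \<le> f y'" using osc[OF y] by fastforce
    qed (use y in blast)
    ultimately show ?thesis by simp
  qed
  then interpret interval_bounded_random_variable P f a "a + c"
    by unfold_locales auto
  show ?thesis using Hoeffdings_lemma_nn_integral[OF l] by simp
qed

text \<open>Induction on the index set in place of a martingale: integrating out one coordinate
  leaves a function \<open>G\<close> of the others with the same bound \<open>K\<close> and the same
  differences \<open>c\<close>, while the coordinate removed contributes one factor from Hoeffding's
  lemma.\<close>

lemma McDiarmid_mgf:
  fixes P :: "'a measure" and I :: "'i set" and F :: "('i \<Rightarrow> 'a) \<Rightarrow> real"
  assumes P: "prob_space P" and "finite I" and l: "l > 0"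
    and "F \<in> borel_measurable (\<Pi>\<^sub>M i\<in>I. P)"
    and "\<And>x. x \<in> space (\<Pi>\<^sub>M i\<in>I. P) \<Longrightarrow> \<bar>F x\<bar> \<le> K"
    and "\<And>x i y. i \<in> I \<Longrightarrow> x \<in> space (\<Pi>\<^sub>M i\<in>I. P) \<Longrightarrow> y \<in> space P \<Longrightarrow> \<bar>F x - F (x(i := y))\<bar> \<le> c"
  shows "(\<integral>\<^sup>+ x. ennreal (exp (l * (F x - (\<integral>x. F x \<partial>(\<Pi>\<^sub>M i\<in>I. P))))) \<partial>(\<Pi>\<^sub>M i\<in>I. P))
      \<le> ennreal (exp (l\<^sup>2 * (real (card I) * c\<^sup>2) / 8))"
  using assms(2,4-)
proof (induction I arbitrary: F rule: finite_induct)
  case empty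
  interpret P: prob_space "\<Pi>\<^sub>M i\<in>{}. P" by (rule prob_space_PiM) (rule P)
  interpret S: product_sigma_finite "\<lambda>_. P"
    by (rule product_sigma_finite.intro) (rule prob_space_imp_sigma_finite[OF P])
  have "(\<integral>x. F x \<partial>(\<Pi>\<^sub>M i\<in>{}. P)) = F (\<lambda>_. undefined)"
    by (simp add: PiM_empty lebesgue_integral_count_space_finite)
  then show ?case by (simp add: S.nn_integral_empty)
next
  case (insert i I)
  note [measurable] = insert.prems(1)
  interpret P: prob_space P by fact
  interpret S: product_sigma_finite "\<lambda>_. P" by unfold_locales
  interpret PI: prob_space "\<Pi>\<^sub>M i\<in>I. P" by (rule prob_space_PiM) (rule P)
  interpret PiI: prob_space "\<Pi>\<^sub>M i\<in>insert i I. P" by (rule prob_space_PiM) (rule P)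
  define G where "G x = (\<integral>y. F (x(i := y)) \<partial>P)" for x
  have upd: "x(i := y) \<in> space (\<Pi>\<^sub>M i\<in>insert i I. P)" if "x \<in> space (\<Pi>\<^sub>M i\<in>I. P)" "y \<in> space P" for x y
    using that by (auto simp: space_PiM PiE_def extensional_def Pi_def)
  have [measurable]: "(\<lambda>(x, y). F (x(i := y))) \<in> borel_measurable ((\<Pi>\<^sub>M i\<in>I. P) \<Otimes>\<^sub>M P)"
    using measurable_compose[OF measurable_add_dim insert.prems(1)] by (simp add: case_prod_unfold)
  have sec: "(\<lambda>y. F (x(i := y))) \<in> borel_measurable P" if "x \<in> space (\<Pi>\<^sub>M i\<in>I. P)" for x
    using measurable_compose[OF measurable_Pair1'[OF that] \<open>(\<lambda>(x, y). F (x(i := y))) \<in> _\<close>] by simp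
  have int: "integrable P (\<lambda>y. F (x(i := y)))" if "x \<in> space (\<Pi>\<^sub>M i\<in>I. P)" for x
    by (rule P.integrable_const_bound[of _ K]) (use that insert.prems(2) upd sec in auto)
  have G_meas[measurable]: "G \<in> borel_measurable (\<Pi>\<^sub>M i\<in>I. P)"
    unfolding G_def by (rule P.borel_measurable_lebesgue_integral) measurable
  define \<mu> where "\<mu> = (\<integral>x. F x \<partial>(\<Pi>\<^sub>M i\<in>insert i I. P))"
  have intF: "integrable (\<Pi>\<^sub>M i\<in>insert i I. P) F"
    by (rule PiI.integrable_const_bound[of _ K]) (use insert.prems in auto)
  have \<mu>: "\<mu> = (\<integral>x. G x \<partial>(\<Pi>\<^sub>M i\<in>I. P))"
    unfolding \<mu>_def G_def by (rule S.product_integral_insert[OF insert.hyps intF])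
  have "\<bar>G x\<bar> \<le> K" if x: "x \<in> space (\<Pi>\<^sub>M i\<in>I. P)" for x
  proof -
    have "\<bar>G x\<bar> \<le> (\<integral>y. \<bar>F (x(i := y))\<bar> \<partial>P)" unfolding G_def by (rule integral_abs_bound)
    also have "\<dots> \<le> (\<integral>y. K \<partial>P)"
      using int[OF x] insert.prems(2) upd[OF x] by (intro integral_mono) auto
    finally show ?thesis by (simp add: P.prob_space)
  qed
  moreover have "\<bar>G x - G (x(j := z))\<bar> \<le> c"
    if x: "x \<in> space (\<Pi>\<^sub>M i\<in>I. P)" and j: "j \<in> I" and z: "z \<in> space P" for x j z
  proof -
    have x': "x(j := z) \<in> space (\<Pi>\<^sub>M i\<in>I. P)"
      using x j z by (auto simp: space_PiM PiE_def extensional_def Pi_def)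
    have "j \<noteq> i" using insert.hyps j by auto
    \<comment> \<open>The two updates commute, which turns this into a change of coordinate
      \<open>j\<close> at the point \<open>x(i := y)\<close>.\<close>
    have "\<bar>F (x(i := y)) - F (x(j := z, i := y))\<bar> \<le> c" if "y \<in> space P" for y
      using insert.prems(3)[of j "x(i := y)" z] upd[OF x that] j z fun_upd_twist[OF \<open>j \<noteq> i\<close>, of x z y]
      by (metis insertI2)
    moreover have "G x - G (x(j := z)) = (\<integral>y. F (x(i := y)) - F (x(j := z, i := y)) \<partial>P)"
      unfolding G_def by (simp add: Bochner_Integration.integral_diff[OF int[OF x] int[OF x']])
    moreover have "\<bar>\<integral>y. F (x(i := y)) - F (x(j := z, i := y)) \<partial>P\<bar>
        \<le> (\<integral>y. \<bar>F (x(i := y)) - F (x(j := z, i := y))\<bar> \<partial>P)" by (rule integral_abs_bound)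
    moreover have "(\<integral>y. \<bar>F (x(i := y)) - F (x(j := z, i := y))\<bar> \<partial>P) \<le> (\<integral>y. c \<partial>P)"
      using int[OF x] int[OF x'] calculation(1) by (intro integral_mono) auto
    moreover have "(\<integral>y. c \<partial>P) = c" by (simp add: P.prob_space)
    ultimately show ?thesis by linarith
  qed
  ultimately have IH: "(\<integral>\<^sup>+ x. ennreal (exp (l * (G x - \<mu>))) \<partial>(\<Pi>\<^sub>M i\<in>I. P))
      \<le> ennreal (exp (l\<^sup>2 * (real (card I) * c\<^sup>2) / 8))"
    unfolding \<mu> by (intro insert.IH G_meas) blast+
  have inner: "(\<integral>\<^sup>+ y. ennreal (exp (l * (F (x(i := y)) - \<mu>))) \<partial>P)
      \<le> ennreal (exp (l * (G x - \<mu>))) * ennreal (exp (l\<^sup>2 * c\<^sup>2 / 8))"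
    if x: "x \<in> space (\<Pi>\<^sub>M i\<in>I. P)" for x
  proof -
    note [measurable] = sec[OF x]
    have "(\<integral>\<^sup>+ y. ennreal (exp (l * (F (x(i := y)) - \<mu>))) \<partial>P)
        = (\<integral>\<^sup>+ y. ennreal (exp (l * (G x - \<mu>))) * ennreal (exp (l * (F (x(i := y)) - G x))) \<partial>P)"
      by (intro nn_integral_cong) (simp add: ennreal_mult[symmetric] exp_add[symmetric] algebra_simps)
    also have "\<dots> = ennreal (exp (l * (G x - \<mu>))) * (\<integral>\<^sup>+ y. ennreal (exp (l * (F (x(i := y)) - G x))) \<partial>P)"
      by (intro nn_integral_cmult) measurable
    also have "(\<integral>\<^sup>+ y. ennreal (exp (l * (F (x(i := y)) - G x))) \<partial>P) \<le> ennreal (exp (l\<^sup>2 * c\<^sup>2 / 8))"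
      unfolding G_def
    proof (rule Hoeffding_oscillation[OF P sec[OF x] _ _ l])
      fix y y' assume y: "y \<in> space P" "y' \<in> space P"
      show "\<bar>F (x(i := y))\<bar> \<le> K" using insert.prems(2) upd x y by blast
      show "\<bar>F (x(i := y)) - F (x(i := y'))\<bar> \<le> c"
        using insert.prems(3)[OF insertI1 upd[OF x y(1)] y(2)] by (simp only: fun_upd_upd)
    qed
    finally show ?thesis by (simp add: mult_left_mono)
  qed
  have "(\<integral>\<^sup>+ x. ennreal (exp (l * (F x - \<mu>))) \<partial>(\<Pi>\<^sub>M i\<in>insert i I. P))
      = (\<integral>\<^sup>+ x. (\<integral>\<^sup>+ y. ennreal (exp (l * (F (x(i := y)) - \<mu>))) \<partial>P) \<partial>(\<Pi>\<^sub>M i\<in>I. P))"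
    by (rule S.product_nn_integral_insert[OF insert.hyps]) measurable
  also have "\<dots> \<le> (\<integral>\<^sup>+ x. ennreal (exp (l * (G x - \<mu>))) * ennreal (exp (l\<^sup>2 * c\<^sup>2 / 8)) \<partial>(\<Pi>\<^sub>M i\<in>I. P))"
    by (intro nn_integral_mono inner)
  also have "\<dots> = (\<integral>\<^sup>+ x. ennreal (exp (l * (G x - \<mu>))) \<partial>(\<Pi>\<^sub>M i\<in>I. P)) * ennreal (exp (l\<^sup>2 * c\<^sup>2 / 8))"
    by (rule nn_integral_multc) measurable
  also have "\<dots> \<le> ennreal (exp (l\<^sup>2 * (real (card I) * c\<^sup>2) / 8)) * ennreal (exp (l\<^sup>2 * c\<^sup>2 / 8))"
    by (intro mult_right_mono IH) simp
  also have "\<dots> = ennreal (exp (l\<^sup>2 * (real (card (insert i I)) * c\<^sup>2) / 8))"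
    using insert.hyps by (simp add: ennreal_mult[symmetric] exp_add[symmetric] field_simps)
  finally show ?case unfolding \<mu>_def .
qed

theorem McDiarmid_inequality:
  fixes P :: "'a measure" and I :: "'i set" and F :: "('i \<Rightarrow> 'a) \<Rightarrow> real"
  assumes P: "prob_space P" and I: "finite I" "I \<noteq> {}" and c: "c > 0" and t: "t > 0"
    and F[measurable]: "F \<in> borel_measurable (\<Pi>\<^sub>M i\<in>I. P)"
    and bd: "\<And>x. x \<in> space (\<Pi>\<^sub>M i\<in>I. P) \<Longrightarrow> \<bar>F x\<bar> \<le> K"
    and diff: "\<And>x i y. i \<in> I \<Longrightarrow> x \<in> space (\<Pi>\<^sub>M i\<in>I. P) \<Longrightarrow> y \<in> space P \<Longrightarrow> \<bar>F x - F (x(i := y))\<bar> \<le> c"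
  shows "measure (\<Pi>\<^sub>M i\<in>I. P) {x \<in> space (\<Pi>\<^sub>M i\<in>I. P). F x \<ge> (\<integral>x. F x \<partial>(\<Pi>\<^sub>M i\<in>I. P)) + t}
    \<le> exp (- 2 * t\<^sup>2 / (real (card I) * c\<^sup>2))"
proof -
  interpret PI: prob_space "\<Pi>\<^sub>M i\<in>I. P" by (rule prob_space_PiM) (rule P)
  define d where "d = real (card I) * c\<^sup>2"
  have d: "d > 0" using I c by (simp add: d_def card_gt_0_iff)
  \<comment> \<open>This \<open>l\<close> minimizes \<open>l * l * d / 8 - l * t\<close>, the
    exponent in the Chernoff bound; the minimum is \<open>- 2 * t * t / d\<close>.\<close>
  define l where "l = 4 * t / d"
  have l: "l > 0" using t d by (simp add: l_def)
  define \<mu> where "\<mu> = (\<integral>x. F x \<partial>(\<Pi>\<^sub>M i\<in>I. P))"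
  have "ennreal (PI.prob {x \<in> space (\<Pi>\<^sub>M i\<in>I. P). F x \<ge> \<mu> + t})
      = emeasure (\<Pi>\<^sub>M i\<in>I. P) {x \<in> space (\<Pi>\<^sub>M i\<in>I. P). F x - \<mu> \<ge> t}"
    by (simp add: PI.emeasure_eq_measure algebra_simps)
  also have "\<dots> \<le> ennreal (exp (- l * t)) * (\<integral>\<^sup>+x\<in>space (\<Pi>\<^sub>M i\<in>I. P). exp (l * (F x - \<mu>)) \<partial>(\<Pi>\<^sub>M i\<in>I. P))"
    by (intro Chernoff_ineq_nn_integral_ge l) auto
  also have "(\<integral>\<^sup>+x\<in>space (\<Pi>\<^sub>M i\<in>I. P). exp (l * (F x - \<mu>)) \<partial>(\<Pi>\<^sub>M i\<in>I. P))
      = (\<integral>\<^sup>+x. exp (l * (F x - \<mu>)) \<partial>(\<Pi>\<^sub>M i\<in>I. P))"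
    by (intro nn_integral_cong) simp
  also have "ennreal (exp (- l * t)) * \<dots> \<le> ennreal (exp (- l * t)) * ennreal (exp (l\<^sup>2 * d / 8))"
    unfolding \<mu>_def d_def by (intro mult_left_mono McDiarmid_mgf[OF P I(1) l F bd diff]) auto
  also have "\<dots> = ennreal (exp (l\<^sup>2 * d / 8 - l * t))"
    by (simp add: ennreal_mult[symmetric] exp_add[symmetric])
  also have "l\<^sup>2 * d / 8 - l * t = - 2 * t\<^sup>2 / d"
    using d by (simp add: l_def field_simps power2_eq_square)
  finally show ?thesis by (simp add: d_def \<mu>_def)
qed

section \<open>Symmetrization and uniform deviation\<close>

lemma e2ennreal_add:
  assumes "0 \<le> a" "0 \<le> b" shows "e2ennreal (a + b) = e2ennreal a + e2ennreal b"
  using assms by (metis e2ennreal_enn2ereal enn2ereal_e2ennreal plus_ennreal.rep_eq)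

section \<open>Mixing the coordinates of two independent samples\<close>

definition mix :: "'i set \<Rightarrow> 'i set \<Rightarrow> ('i \<Rightarrow> 'a) \<Rightarrow> ('i \<Rightarrow> 'a) \<Rightarrow> 'i \<Rightarrow> 'a" where
  "mix I A z z' = (\<lambda>i\<in>I. if i \<in> A then z i else z' i)"

lemma measurable_mix[measurable]:
  "(\<lambda>(z, z'). mix I A z z') \<in> measurable ((\<Pi>\<^sub>M i\<in>I. P) \<Otimes>\<^sub>M (\<Pi>\<^sub>M i\<in>I. P)) (\<Pi>\<^sub>M i\<in>I. P)"
  unfolding mix_def case_prod_unfold
proof (rule measurable_restrict)
  fix i assume [measurable]: "i \<in> I"
  show "(\<lambda>p. if i \<in> A then fst p i else snd p i) \<in> measurable ((\<Pi>\<^sub>M i\<in>I. P) \<Otimes>\<^sub>M (\<Pi>\<^sub>M i\<in>I. P)) P"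
    by (cases "i \<in> A") (simp_all, measurable)
qed

text \<open>The preimage of a box is a product of two boxes, with \<open>E i\<close> in the first
  for \<open>i \<in> A\<close> and in the second otherwise, opposite the whole space; so every
  \<open>emeasure P (E i)\<close> occurs exactly once.\<close>

lemma distr_mix:
  assumes P: "prob_space P" and I: "finite I"
  shows "distr ((\<Pi>\<^sub>M i\<in>I. P) \<Otimes>\<^sub>M (\<Pi>\<^sub>M i\<in>I. P)) (\<Pi>\<^sub>M i\<in>I. P) (\<lambda>(z, z'). mix I A z z') = (\<Pi>\<^sub>M i\<in>I. P)"
proof -
  interpret P: prob_space P by fact
  interpret S: product_sigma_finite "\<lambda>_. P" by unfold_locales
  interpret PI: prob_space "\<Pi>\<^sub>M i\<in>I. P" by (rule prob_space_PiM) (rule P)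
  show ?thesis
  proof (rule S.PiM_eqI[OF I])
    fix E assume E: "\<And>i. i \<in> I \<Longrightarrow> E i \<in> sets P"
    let ?E1 = "\<lambda>i. if i \<in> A then E i else space P" and ?E2 = "\<lambda>i. if i \<in> A then space P else E i"
    have sub: "E i \<subseteq> space P" if "i \<in> I" for i using E[OF that] by (rule sets.sets_into_space)
    have "(\<lambda>(z, z'). mix I A z z') -` (Pi\<^sub>E I E) \<inter> space ((\<Pi>\<^sub>M i\<in>I. P) \<Otimes>\<^sub>M (\<Pi>\<^sub>M i\<in>I. P))
        = (Pi\<^sub>E I ?E1) \<times> (Pi\<^sub>E I ?E2)"
      using sub
      by (auto simp: space_pair_measure space_PiM mix_def PiE_def Pi_def extensional_def
          split: if_split_asm) (metis subsetD)+
    then have "emeasure (distr ((\<Pi>\<^sub>M i\<in>I. P) \<Otimes>\<^sub>M (\<Pi>\<^sub>M i\<in>I. P)) (\<Pi>\<^sub>M i\<in>I. P) (\<lambda>(z, z'). mix I A z z')) (Pi\<^sub>E I E)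
        = emeasure (\<Pi>\<^sub>M i\<in>I. P) (Pi\<^sub>E I ?E1) * emeasure (\<Pi>\<^sub>M i\<in>I. P) (Pi\<^sub>E I ?E2)"
      using E I by (simp add: emeasure_distr sets_PiM_I_finite PI.emeasure_pair_measure_Times)
    also have "\<dots> = (\<Prod>i\<in>I. emeasure P (?E1 i)) * (\<Prod>i\<in>I. emeasure P (?E2 i))"
      using E by (subst (1 2) S.emeasure_PiM[OF I]) auto
    also have "\<dots> = (\<Prod>i\<in>I. emeasure P (E i))"
      unfolding prod.distrib[symmetric] by (intro prod.cong) (auto simp: P.emeasure_space_1)
    finally show "emeasure (distr ((\<Pi>\<^sub>M i\<in>I. P) \<Otimes>\<^sub>M (\<Pi>\<^sub>M i\<in>I. P)) (\<Pi>\<^sub>M i\<in>I. P) (\<lambda>(z, z'). mix I A z z')) (Pi\<^sub>E I E)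
        = (\<Prod>i\<in>I. emeasure P (E i))" .
  qed simp
qed

lemma nn_integral_mix:
  assumes P: "prob_space P" and I: "finite I" and [measurable]: "f \<in> borel_measurable (\<Pi>\<^sub>M i\<in>I. P)"
  shows "(\<integral>\<^sup>+ z. \<integral>\<^sup>+ z'. f (mix I A z z') \<partial>(\<Pi>\<^sub>M i\<in>I. P) \<partial>(\<Pi>\<^sub>M i\<in>I. P)) = (\<integral>\<^sup>+ z. f z \<partial>(\<Pi>\<^sub>M i\<in>I. P))"
proof -
  interpret PI: prob_space "\<Pi>\<^sub>M i\<in>I. P" by (rule prob_space_PiM) (rule P)
  have "(\<integral>\<^sup>+ z. f z \<partial>(\<Pi>\<^sub>M i\<in>I. P)) = (\<integral>\<^sup>+ p. f (case p of (z, z') \<Rightarrow> mix I A z z') \<partial>((\<Pi>\<^sub>M i\<in>I. P) \<Otimes>\<^sub>M (\<Pi>\<^sub>M i\<in>I. P)))"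
    by (subst distr_mix[OF P I, of A, symmetric], subst nn_integral_distr) simp_all
  also have "\<dots> = (\<integral>\<^sup>+ z. \<integral>\<^sup>+ z'. f (mix I A z z') \<partial>(\<Pi>\<^sub>M i\<in>I. P) \<partial>(\<Pi>\<^sub>M i\<in>I. P))"
    by (subst PI.nn_integral_fst[symmetric]) simp_all
  finally show ?thesis ..
qed

section \<open>Bounded loss classes that are measurable for the completion of the law\<close>

locale bounded_class = prob_space P for P :: "'a measure" +
  fixes X0 :: "'a set" and B :: real and n :: nat and G :: "('a \<Rightarrow> ereal) set"
  assumes X0: "X0 \<in> sets P" "prob X0 = 1"
    and n: "n \<ge> 1"
    and G_nonempty: "G \<noteq> {}"
    and G_bounded: "\<And>g x. g \<in> G \<Longrightarrow> x \<in> X0 \<Longrightarrow> 0 \<le> g x \<and> g x \<le> ereal B"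
    and G_measurable: "\<And>g. g \<in> G \<Longrightarrow> g \<in> borel_measurable (completion P)"
begin

\<comment> \<open>otherwise the simplifier rewrites \<open>{1..n}\<close> to \<open>{Suc 0..n}\<close>\<close>
declare One_nat_def[simp del]

abbreviation N where "N \<equiv> \<Pi>\<^sub>M i\<in>{1..n}. P"

sublocale N: prob_space N by (rule prob_space_PiM) (rule prob_space_axioms)

text \<open>On this set of full measure all losses are real numbers, so extended-real means may be
  replaced by \<open>avg\<close>.\<close>

definition good :: "(nat \<Rightarrow> 'a) set" where "good = {z \<in> space N. \<forall>i\<in>{1..n}. z i \<in> X0}"

definition avg :: "('a \<Rightarrow> ereal) \<Rightarrow> (nat \<Rightarrow> 'a) \<Rightarrow> real" where
  "avg g z = (\<Sum>i=1..n. real_of_ereal (g (z i))) / n"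

lemma X0_nonempty: "X0 \<noteq> {}" using X0(2) by auto

lemma AE_X0: "AE x in P. x \<in> X0" using prob_eq_1[OF X0(1)] X0(2) by simp

lemma AE_component: "i \<in> {1..n} \<Longrightarrow> AE x in P. R x \<Longrightarrow> AE z in N. R (z i)"
  by (rule AE_PiM_component) (use prob_space_axioms in auto)

lemma AE_good: "AE z in N. z \<in> good"
proof -
  have "AE z in N. \<forall>i\<in>{1..n}. z i \<in> X0"
    by (intro AE_finite_allI AE_component AE_X0) auto
  then show ?thesis using AE_space by eventually_elim (simp add: good_def)
qed

lemma ereal_val: "g \<in> G \<Longrightarrow> x \<in> X0 \<Longrightarrow> ereal (real_of_ereal (g x)) = g x"
  using G_bounded[of g x] by (cases "g x") auto

lemma val_bounds: "g \<in> G \<Longrightarrow> x \<in> X0 \<Longrightarrow> 0 \<le> real_of_ereal (g x) \<and> real_of_ereal (g x) \<le> B"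
  using G_bounded[of g x] by (cases "g x") auto

lemma B_nonneg: "0 \<le> B"
  using val_bounds X0_nonempty G_nonempty by fastforce

lemma avg_bounds:
  assumes "g \<in> G" "z \<in> good" shows "0 \<le> avg g z" "avg g z \<le> B"
proof -
  have v: "0 \<le> real_of_ereal (g (z i)) \<and> real_of_ereal (g (z i)) \<le> B" if "i \<in> {1..n}" for i
    using val_bounds[OF assms(1)] assms(2) that by (auto simp: good_def)
  show "0 \<le> avg g z" unfolding avg_def using v by (intro divide_nonneg_nonneg sum_nonneg) auto
  have "(\<Sum>i=1..n. real_of_ereal (g (z i))) \<le> (\<Sum>i=1..n. B)" using v by (intro sum_mono) auto
  then show "avg g z \<le> B" unfolding avg_def using n by (simp add: field_simps)
qed

lemma empirical_mean_eq: "g \<in> G \<Longrightarrow> z \<in> good \<Longrightarrow> empirical_mean n g z = ereal (avg g z)"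
proof -
  assume *: "g \<in> G" "z \<in> good"
  have "(\<Sum>i=1..n. g (z i)) = (\<Sum>i=1..n. ereal (real_of_ereal (g (z i))))"
    using ereal_val[OF *(1)] *(2) by (intro sum.cong) (auto simp: good_def)
  then show ?thesis using n by (simp add: empirical_mean_def avg_def)
qed

text \<open>Completion measurability provides a function that is measurable for \<open>P\<close> and
  agrees almost everywhere; truncation at \<open>B\<close> makes the bounds hold everywhere, so that
  integrability over \<open>P\<close> and over product coordinates is immediate.\<close>

lemma measurable_version:
  assumes "g \<in> G"
  obtains h where "h \<in> borel_measurable P" "\<And>x. 0 \<le> h x \<and> h x \<le> B"
    "AE x in P. h x = real_of_ereal (g x)" "expect P g = ereal (\<integral>x. h x \<partial>P)"
proof -
  have "(\<lambda>x. e2ennreal (g x)) \<in> borel_measurable (completion P)"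
    using G_measurable[OF assms] by (rule measurable_compose) (rule measurable_e2ennreal)
  from completion_ex_borel_measurable[OF this] obtain g' where
    g'[measurable]: "g' \<in> borel_measurable P" and ae: "AE x in P. e2ennreal (g x) = g' x" by blast
  define h where "h x = min B (enn2real (g' x))" for x
  have h: "h \<in> borel_measurable P" "\<And>x. 0 \<le> h x \<and> h x \<le> B"
    using B_nonneg by (auto simp: h_def[abs_def])
  have eq: "AE x in P. h x = real_of_ereal (g x) \<and> e2ennreal (g x) = ennreal (h x)"
    using ae AE_X0
  proof eventually_elim
    case (elim x)
    then have "g' x = ennreal (real_of_ereal (g x))"
      using ereal_val[OF assms, of x] by (metis e2ennreal_ereal)
    then show ?case using elim val_bounds[OF assms, of x] by (simp add: h_def min_def)
  qed
  have int: "integrable P h" by (rule integrable_const_bound[of _ B]) (use h in auto)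
  have "(\<integral>\<^sup>+ x. e2ennreal (g x) \<partial>P) = (\<integral>\<^sup>+ x. ennreal (h x) \<partial>P)"
    by (rule nn_integral_cong_AE) (use eq in auto)
  also have "\<dots> = ennreal (\<integral>x. h x \<partial>P)" using int h by (intro nn_integral_eq_integral) auto
  finally have "expect P g = ereal (\<integral>x. h x \<partial>P)"
    using h by (simp add: expect_def enn2ereal_ennreal integral_nonneg)
  with h eq show ?thesis using that[of h] by auto
qed

lemma expect_bounds:
  assumes "g \<in> G" shows "\<exists>e. expect P g = ereal e \<and> 0 \<le> e \<and> e \<le> B"
proof -
  obtain h where h: "h \<in> borel_measurable P" "\<And>x. 0 \<le> h x \<and> h x \<le> B" "expect P g = ereal (\<integral>x. h x \<partial>P)"
    using measurable_version[OF assms] by metis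
  have "integrable P h" by (rule integrable_const_bound[of _ B]) (use h in auto)
  then have "(\<integral>x. h x \<partial>P) \<le> (\<integral>x. B \<partial>P)" using h by (intro integral_mono) auto
  with h show ?thesis by (auto simp: prob_space integral_nonneg)
qed

lemma uniform_deviation_bounds:
  assumes "z \<in> good" shows "0 \<le> uniform_deviation P n G z" "uniform_deviation P n G z \<le> ereal B"
proof -
  have b: "\<bar>empirical_mean n g z - expect P g\<bar> \<le> ereal B" if "g \<in> G" for g
    using expect_bounds[OF that] avg_bounds[OF that assms] empirical_mean_eq[OF that assms] by auto
  show "uniform_deviation P n G z \<le> ereal B" unfolding uniform_deviation_def by (intro SUP_least b)
  obtain g where "g \<in> G" using G_nonempty by blast
  then show "0 \<le> uniform_deviation P n G z" unfolding uniform_deviation_def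
    by (intro SUP_upper2[of g]) auto
qed

lemma rademacher_term:
  assumes "g \<in> G" "z \<in> good"
  shows "ereal \<bar>(\<Sum>i=1..n. \<sigma> i * real_of_ereal (g (z i))) / n\<bar> \<le> rademacher_sup n G (z, \<sigma>)"
proof -
  have "(\<Sum>i=1..n. ereal (\<sigma> i) * g (z i)) = (\<Sum>i=1..n. ereal (\<sigma> i * real_of_ereal (g (z i))))"
  proof (intro sum.cong refl)
    fix i assume "i \<in> {1..n}"
    then have "z i \<in> X0" using assms(2) by (simp add: good_def)
    then show "ereal (\<sigma> i) * g (z i) = ereal (\<sigma> i * real_of_ereal (g (z i)))"
      using ereal_val[OF assms(1)] by (metis times_ereal.simps(1))
  qed
  then have "\<bar>(\<Sum>i=1..n. ereal (\<sigma> i) * g (z i)) / ereal (real n)\<bar>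
      = ereal \<bar>(\<Sum>i=1..n. \<sigma> i * real_of_ereal (g (z i))) / n\<bar>"
    using n by simp
  then show ?thesis unfolding rademacher_sup_def by (simp, metis (lifting) SUP_upper assms(1))
qed

lemma mix_good: "z \<in> good \<Longrightarrow> z' \<in> good \<Longrightarrow> mix {1..n} A z z' \<in> good"
  by (auto simp: good_def mix_def space_PiM PiE_iff)

lemma avg_diff_le_rademacher:
  assumes g: "g \<in> G" and z: "z \<in> good" "z' \<in> good"
    and \<sigma>: "\<And>i. i \<in> {1..n} \<Longrightarrow> \<sigma> i \<in> {-1, 1}" and A: "A = {i. \<sigma> i = (1::real)}"
  shows "ereal \<bar>avg g z - avg g z'\<bar> \<le>
    rademacher_sup n G (mix {1..n} A z z', \<sigma>) + rademacher_sup n G (mix {1..n} (- A) z z', \<sigma>)"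
proof -
  let ?v = "\<lambda>z i. real_of_ereal (g (z i))"
  let ?s = "\<lambda>z. (\<Sum>i=1..n. \<sigma> i * ?v z i) / n"
  have "avg g z - avg g z' = ?s (mix {1..n} A z z') - ?s (mix {1..n} (- A) z z')"
    unfolding avg_def diff_divide_distrib[symmetric] sum_subtractf[symmetric]
  proof (intro arg_cong2[where f = "(/)"] sum.cong refl)
    fix i assume i: "i \<in> {1..n}"
    \<comment> \<open>For sign 1 the two mixtures carry \<open>z i\<close> and \<open>z' i\<close>;
      for sign -1 they carry them in the opposite order, and the sign undoes the exchange.\<close>
    then show "?v z i - ?v z' i = \<sigma> i * ?v (mix {1..n} A z z') i - \<sigma> i * ?v (mix {1..n} (- A) z z') i"
      using \<sigma>[OF i] by (auto simp: mix_def A)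
  qed
  then have "\<bar>avg g z - avg g z'\<bar> \<le> \<bar>?s (mix {1..n} A z z')\<bar> + \<bar>?s (mix {1..n} (- A) z z')\<bar>"
    by linarith
  then have "ereal \<bar>avg g z - avg g z'\<bar>
      \<le> ereal \<bar>?s (mix {1..n} A z z')\<bar> + ereal \<bar>?s (mix {1..n} (- A) z z')\<bar>"
    by (simp only: plus_ereal.simps ereal_less_eq)
  also have "\<dots> \<le> rademacher_sup n G (mix {1..n} A z z', \<sigma>) + rademacher_sup n G (mix {1..n} (- A) z z', \<sigma>)"
    by (intro add_mono rademacher_term[OF g] mix_good z)
  finally show ?thesis .
qed

text \<open>With \<open>A\<close> the set of positive signs, the difference of the averages over \<open>z\<close> and \<open>z'\<close> is the difference
  of the signed averages over the two mixtures of \<open>z\<close> and \<open>z'\<close>, each distributed as the sample.\<close>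

lemma uniform_deviation_le_ghost:
  assumes z: "z \<in> good" and \<sigma>: "\<And>i. i \<in> {1..n} \<Longrightarrow> \<sigma> i \<in> {-1, 1}" and A: "A = {i. \<sigma> i = (1::real)}"
  shows "e2ennreal (uniform_deviation P n G z) \<le>
    (\<integral>\<^sup>+ z'. e2ennreal (rademacher_sup n G (mix {1..n} A z z', \<sigma>))
          + e2ennreal (rademacher_sup n G (mix {1..n} (- A) z z', \<sigma>)) \<partial>N)"
    (is "_ \<le> ?rhs")
proof -
  have "\<bar>empirical_mean n g z - expect P g\<bar> \<le> enn2ereal ?rhs" if g: "g \<in> G" for g
  proof -
    obtain h where h[measurable]: "h \<in> borel_measurable P" and hb: "\<And>x. 0 \<le> h x \<and> h x \<le> B"
      and hg: "AE x in P. h x = real_of_ereal (g x)" and he: "expect P g = ereal (\<integral>x. h x \<partial>P)"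
      using measurable_version[OF g] by metis
    \<comment> \<open>\<open>avg g\<close> itself need not be measurable for \<open>N\<close>;
      \<open>H\<close> is the same average built from the measurable version and equals it almost
      everywhere.\<close>
    define H where "H z' = (\<Sum>i=1..n. h (z' i)) / n" for z'
    have H[measurable]: "H \<in> borel_measurable N" unfolding H_def by measurable
    have int_i: "integrable N (\<lambda>z'. h (z' i))" if "i \<in> {1..n}" for i
      by (rule N.integrable_const_bound[of _ B]) (use hb that in auto)
    have "(\<integral>z'. h (z' i) \<partial>N) = (\<integral>x. h x \<partial>P)" if i: "i \<in> {1..n}" for i
    proof -
      have "distr N P (\<lambda>z'. z' i) = P"
        by (rule distr_PiM_component) (use i prob_space_axioms in auto)
      then have "(\<integral>x. h x \<partial>P) = (\<integral>x. h x \<partial>(distr N P (\<lambda>z'. z' i)))" by simp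
      also have "\<dots> = (\<integral>z'. h (z' i) \<partial>N)" using i by (intro integral_distr) auto
      finally show ?thesis ..
    qed
    then have EH: "(\<integral>z'. H z' \<partial>N) = (\<integral>x. h x \<partial>P)"
      unfolding H_def using n int_i by (simp add: Bochner_Integration.integral_sum)
    have iH: "integrable N H" unfolding H_def using int_i by (intro integrable_divide Bochner_Integration.integrable_sum)
    have "AE z' in N. \<forall>i\<in>{1..n}. h (z' i) = real_of_ereal (g (z' i))"
      by (intro AE_finite_allI AE_component hg) auto
    then have ae: "AE z' in N. H z' = avg g z' \<and> z' \<in> good"
      using AE_good by eventually_elim (simp add: H_def avg_def)
    \<comment> \<open>The expected loss is the mean of the ghost average; the absolute value is then
      moved under the integral while \<open>g\<close> is still fixed.\<close>
    have "\<bar>avg g z - (\<integral>x. h x \<partial>P)\<bar> = \<bar>\<integral>z'. avg g z - H z' \<partial>N\<bar>"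
      by (subst Bochner_Integration.integral_diff[OF _ iH])
         (use EH N.prob_space in simp_all)
    also have "\<dots> \<le> (\<integral>z'. \<bar>avg g z - H z'\<bar> \<partial>N)" by (rule integral_abs_bound)
    finally have "ennreal \<bar>avg g z - (\<integral>x. h x \<partial>P)\<bar> \<le> ennreal (\<integral>z'. \<bar>avg g z - H z'\<bar> \<partial>N)"
      by (rule ennreal_leI)
    also have "\<dots> = (\<integral>\<^sup>+ z'. ennreal \<bar>avg g z - H z'\<bar> \<partial>N)"
      using iH by (intro nn_integral_eq_integral[symmetric]) auto
    also have "\<dots> \<le> ?rhs"
    proof (rule nn_integral_mono_AE)
      show "AE z' in N. ennreal \<bar>avg g z - H z'\<bar> \<le> e2ennreal (rademacher_sup n G (mix {1..n} A z z', \<sigma>))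
          + e2ennreal (rademacher_sup n G (mix {1..n} (- A) z z', \<sigma>))"
        using ae
      proof eventually_elim
        case (elim z')
        have nn: "0 \<le> rademacher_sup n G (y, \<sigma>)" for y
          using G_nonempty unfolding rademacher_sup_def by (auto intro: SUP_upper2)
        have "e2ennreal (ereal \<bar>avg g z - avg g z'\<bar>) \<le> e2ennreal (rademacher_sup n G (mix {1..n} A z z', \<sigma>)
            + rademacher_sup n G (mix {1..n} (- A) z z', \<sigma>))"
          using elim by (intro e2ennreal_mono avg_diff_le_rademacher[OF g z _ \<sigma> A]) auto
        also have "\<dots> = e2ennreal (rademacher_sup n G (mix {1..n} A z z', \<sigma>))
            + e2ennreal (rademacher_sup n G (mix {1..n} (- A) z z', \<sigma>))"
          using nn by (intro e2ennreal_add)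
        finally show ?case using elim by simp
      qed
    qed
    finally have "enn2ereal (ennreal \<bar>avg g z - (\<integral>x. h x \<partial>P)\<bar>) \<le> enn2ereal ?rhs"
      by (simp add: less_eq_ennreal.rep_eq)
    then show ?thesis by (simp add: he empirical_mean_eq[OF g z] enn2ereal_ennreal)
  qed
  then have "uniform_deviation P n G z \<le> enn2ereal ?rhs"
    unfolding uniform_deviation_def by (rule SUP_least)
  then have "e2ennreal (uniform_deviation P n G z) \<le> e2ennreal (enn2ereal ?rhs)" by (rule e2ennreal_mono)
  then show ?thesis by simp
qed

abbreviation signs where "signs \<equiv> \<Pi>\<^sub>M i\<in>{1..n}. uniform_count_measure {-1, 1 :: real}"

text \<open>Both mixtures are distributed as the sample, so each fixed sign vector contributes the
  same integral twice, whence the factor 2. Averaging over the signs comes last and leaves the left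
  side as it is.\<close>

lemma expected_deviation_le:
  assumes dev: "uniform_deviation P n G \<in> borel_measurable N"
    and rad: "rademacher_sup n G \<in> borel_measurable (rademacher_space P n)"
  shows "(\<integral>\<^sup>+ z. e2ennreal (uniform_deviation P n G z) \<partial>N)
    \<le> 2 * (\<integral>\<^sup>+ p. e2ennreal (rademacher_sup n G p) \<partial>(rademacher_space P n))"
proof -
  interpret S: prob_space signs
    by (intro prob_space_PiM prob_space_uniform_count_measure) auto
  interpret NS: pair_sigma_finite N signs ..
  have rad': "(\<lambda>p. e2ennreal (rademacher_sup n G p)) \<in> borel_measurable (N \<Otimes>\<^sub>M signs)"
    using rad[unfolded rademacher_space_def] by (rule measurable_compose) (rule measurable_e2ennreal)
  have "(\<integral>\<^sup>+ z. e2ennreal (uniform_deviation P n G z) \<partial>N)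
      \<le> 2 * (\<integral>\<^sup>+ z. e2ennreal (rademacher_sup n G (z, \<sigma>)) \<partial>N)" if \<sigma>: "\<sigma> \<in> space signs" for \<sigma>
  proof -
    have [measurable]: "(\<lambda>z. e2ennreal (rademacher_sup n G (z, \<sigma>))) \<in> borel_measurable N"
      by (rule measurable_compose[OF measurable_Pair2'[OF \<sigma>] rad'])
    have pm: "\<And>i. i \<in> {1..n} \<Longrightarrow> \<sigma> i \<in> {-1, 1}"
      using \<sigma> by (auto simp: space_PiM space_uniform_count_measure PiE_def Pi_def)
    define A where "A = {i. \<sigma> i = 1}"
    have "(\<integral>\<^sup>+ z. e2ennreal (uniform_deviation P n G z) \<partial>N)
      \<le> (\<integral>\<^sup>+ z. \<integral>\<^sup>+ z'. e2ennreal (rademacher_sup n G (mix {1..n} A z z', \<sigma>))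
          + e2ennreal (rademacher_sup n G (mix {1..n} (- A) z z', \<sigma>)) \<partial>N \<partial>N)"
    proof (rule nn_integral_mono_AE)
      show "AE z in N. e2ennreal (uniform_deviation P n G z)
        \<le> (\<integral>\<^sup>+ z'. e2ennreal (rademacher_sup n G (mix {1..n} A z z', \<sigma>))
          + e2ennreal (rademacher_sup n G (mix {1..n} (- A) z z', \<sigma>)) \<partial>N)"
        using AE_good by eventually_elim (rule uniform_deviation_le_ghost[OF _ pm A_def])
    qed
    also have "\<dots> = (\<integral>\<^sup>+ z. (\<integral>\<^sup>+ z'. e2ennreal (rademacher_sup n G (mix {1..n} A z z', \<sigma>)) \<partial>N)
        + (\<integral>\<^sup>+ z'. e2ennreal (rademacher_sup n G (mix {1..n} (- A) z z', \<sigma>)) \<partial>N) \<partial>N)"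
      by (intro nn_integral_cong nn_integral_add) measurable
    also have "\<dots> = (\<integral>\<^sup>+ z. \<integral>\<^sup>+ z'. e2ennreal (rademacher_sup n G (mix {1..n} A z z', \<sigma>)) \<partial>N \<partial>N)
        + (\<integral>\<^sup>+ z. \<integral>\<^sup>+ z'. e2ennreal (rademacher_sup n G (mix {1..n} (- A) z z', \<sigma>)) \<partial>N \<partial>N)"
      by (intro nn_integral_add) measurable
    also have "\<dots> = 2 * (\<integral>\<^sup>+ z. e2ennreal (rademacher_sup n G (z, \<sigma>)) \<partial>N)"
      by (subst (1 2) nn_integral_mix[OF prob_space_axioms,
            where f = "\<lambda>z. e2ennreal (rademacher_sup n G (z, \<sigma>))"]) (simp_all add: mult_2)
    finally show ?thesis .
  qed
  then have "(\<integral>\<^sup>+ \<sigma>. (\<integral>\<^sup>+ z. e2ennreal (uniform_deviation P n G z) \<partial>N) \<partial>signs)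
      \<le> (\<integral>\<^sup>+ \<sigma>. 2 * (\<integral>\<^sup>+ z. e2ennreal (rademacher_sup n G (z, \<sigma>)) \<partial>N) \<partial>signs)"
    by (intro nn_integral_mono)
  also have "\<dots> = 2 * (\<integral>\<^sup>+ \<sigma>. (\<integral>\<^sup>+ z. e2ennreal (rademacher_sup n G (z, \<sigma>)) \<partial>N) \<partial>signs)"
    using measurable_pair_swap[OF rad']
    by (intro nn_integral_cmult N.borel_measurable_nn_integral) (simp add: case_prod_unfold)
  also have "(\<integral>\<^sup>+ \<sigma>. (\<integral>\<^sup>+ z. e2ennreal (rademacher_sup n G (z, \<sigma>)) \<partial>N) \<partial>signs)
      = (\<integral>\<^sup>+ p. e2ennreal (rademacher_sup n G p) \<partial>(N \<Otimes>\<^sub>M signs))"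
    by (rule NS.nn_integral_snd) (use rad' in simp)
  finally show ?thesis by (simp add: S.emeasure_space_1 rademacher_space_def)
qed

theorem uniform_deviation_concentration:
  assumes dev[measurable]: "uniform_deviation P n G \<in> borel_measurable N"
    and rad: "rademacher_sup n G \<in> borel_measurable (rademacher_space P n)"
    and \<delta>: "0 < \<delta>" "\<delta> < 1"
  shows "1 - \<delta> \<le> N.prob {z \<in> space N. uniform_deviation P n G z
    \<le> 2 * rademacher_complexity P n G + ereal (B * sqrt (ln (2 / \<delta>) / (2 * n)))}"
proof -
  define t where "t = B * sqrt (ln (2 / \<delta>) / (2 * n))"
  obtain x0 where x0: "x0 \<in> X0" using X0_nonempty by blast
  \<comment> \<open>the losses are only bounded on \<open>X0\<close>, so bounded differences hold after mapping every point into it\<close>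
  define r where "r x = (if x \<in> X0 then x else x0)" for x
  define R where "R z = (\<lambda>i\<in>{1..n}. r (z i))" for z
  have X0_space: "x \<in> X0 \<Longrightarrow> x \<in> space P" for x using sets.sets_into_space[OF X0(1)] by blast
  have [measurable]: "r \<in> measurable P P"
    unfolding r_def by (rule measurable_If_set) (use x0 X0 X0_space in auto)
  have R_meas[measurable]: "R \<in> measurable N N" unfolding R_def by measurable
  have R_good: "R z \<in> good" for z
    using x0 X0_space by (auto simp: good_def R_def r_def space_PiM)
  have R_id: "R z = z" if "z \<in> good" for z
    using that by (auto simp: good_def R_def r_def space_PiM PiE_def extensional_def)
  define F where "F z = real_of_ereal (uniform_deviation P n G (R z))" for z
  have F_meas[measurable]: "F \<in> borel_measurable N" unfolding F_def by measurable
  have F: "ereal (F z) = uniform_deviation P n G (R z)" "0 \<le> F z" "F z \<le> B" for z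
    using uniform_deviation_bounds[OF R_good[of z]] unfolding F_def
    by (cases "uniform_deviation P n G (R z)"; simp)+
  have F_ae: "AE z in N. ereal (F z) = uniform_deviation P n G z"
    using AE_good by eventually_elim (simp add: F R_id)
  \<comment> \<open>Averages over two samples that differ in one coordinate are at most
    \<open>B / n\<close> apart, as the values lie between 0 and \<open>B\<close>, and the supremum
    inherits this. Exchanging the samples later gives the absolute value.\<close>
  have one_sided: "F z - F z' \<le> B / n"
    if i: "i \<in> {1..n}" and eq: "\<And>j. j \<in> {1..n} \<Longrightarrow> j \<noteq> i \<Longrightarrow> z j = z' j" for z z' i
  proof -
    have "\<bar>empirical_mean n g (R z) - expect P g\<bar> \<le> ereal (F z' + B / n)" if g: "g \<in> G" for g
    proof -
      let ?v = "\<lambda>z j. real_of_ereal (g (R z j))"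
      obtain e where e: "expect P g = ereal e" using expect_bounds[OF g] by blast
      have "\<bar>empirical_mean n g (R z') - expect P g\<bar> \<le> ereal (F z')"
        unfolding F(1) uniform_deviation_def by (rule SUP_upper[OF g])
      then have 1: "\<bar>avg g (R z') - e\<bar> \<le> F z'" by (simp add: empirical_mean_eq[OF g R_good] e)
      have "(\<Sum>j=1..n. ?v z j) - (\<Sum>j=1..n. ?v z' j) = (\<Sum>j=1..n. if j = i then ?v z i - ?v z' i else 0)"
        unfolding sum_subtractf[symmetric] by (intro sum.cong refl) (auto simp: R_def eq)
      also have "\<dots> = ?v z i - ?v z' i" using i by simp
      finally have "avg g (R z) - avg g (R z') = (?v z i - ?v z' i) / n"
        unfolding avg_def diff_divide_distrib[symmetric] by simp
      moreover have "\<bar>?v z i - ?v z' i\<bar> \<le> B"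
      proof -
        have "R z i \<in> X0" "R z' i \<in> X0" using R_good i by (auto simp: good_def)
        from val_bounds[OF g this(1)] val_bounds[OF g this(2)] show ?thesis by linarith
      qed
      ultimately have "\<bar>avg g (R z) - avg g (R z')\<bar> \<le> B / n"
        by (simp add: abs_divide divide_right_mono)
      with 1 show ?thesis by (simp add: empirical_mean_eq[OF g R_good] e)
    qed
    then have "uniform_deviation P n G (R z) \<le> ereal (F z' + B / n)"
      unfolding uniform_deviation_def by (rule SUP_least)
    then show ?thesis by (simp flip: F(1))
  qed
  have diff: "\<bar>F z - F (z(i := y))\<bar> \<le> B / n" if "i \<in> {1..n}" for z i y
    using one_sided[OF that, of z "z(i := y)"] one_sided[OF that, of "z(i := y)" z] by auto
  have intF: "integrable N F" by (rule N.integrable_const_bound[of _ B]) (use F in auto)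
  have EF: "ereal (\<integral>z. F z \<partial>N) \<le> 2 * rademacher_complexity P n G"
  proof -
    have "ennreal (\<integral>z. F z \<partial>N) = (\<integral>\<^sup>+ z. ennreal (F z) \<partial>N)"
      using intF F by (intro nn_integral_eq_integral[symmetric]) auto
    also have "\<dots> = (\<integral>\<^sup>+ z. e2ennreal (uniform_deviation P n G z) \<partial>N)"
      by (rule nn_integral_cong_AE) (use F_ae in \<open>eventually_elim, metis e2ennreal_ereal\<close>)
    also have "\<dots> \<le> 2 * (\<integral>\<^sup>+ p. e2ennreal (rademacher_sup n G p) \<partial>(rademacher_space P n))"
      by (rule expected_deviation_le[OF dev rad])
    finally have "enn2ereal (ennreal (\<integral>z. F z \<partial>N))
        \<le> enn2ereal (2 * (\<integral>\<^sup>+ p. e2ennreal (rademacher_sup n G p) \<partial>(rademacher_space P n)))"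
      by (simp add: less_eq_ennreal.rep_eq)
    then show ?thesis
      using F by (simp add: rademacher_complexity_def expect_def times_ennreal.rep_eq
          enn2ereal_ennreal integral_nonneg)
  qed
  have tail: "N.prob {z \<in> space N. \<not> F z \<le> (\<integral>z. F z \<partial>N) + t} \<le> \<delta>"
  \<comment> \<open>McDiarmid's inequality is stated for positive \<open>c\<close> and
    \<open>t\<close>, and both vanish with \<open>B\<close>; in that case \<open>F\<close> is
    identically zero.\<close>
  proof (cases "B = 0")
    case True
    then have "F z = 0" for z using F[of z] by simp
    then show ?thesis using \<delta> True by (simp add: t_def)
  next
    case False
    then have B: "B > 0" using B_nonneg by simp
    have ln: "ln (2 / \<delta>) > 0" using \<delta> by simp
    have t: "t > 0" using B ln n by (simp add: t_def)
    have "N.prob {z \<in> space N. \<not> F z \<le> (\<integral>z. F z \<partial>N) + t}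
        \<le> N.prob {z \<in> space N. F z \<ge> (\<integral>z. F z \<partial>N) + t}"
      by (rule N.finite_measure_mono) auto
    also have "\<dots> \<le> exp (- 2 * t\<^sup>2 / (real (card {1..n}) * (B / n)\<^sup>2))"
      using n B F(2,3) diff
      by (intro McDiarmid_inequality[OF prob_space_axioms _ _ _ t F_meas, of _ B]) auto
    also have "- 2 * t\<^sup>2 / (real (card {1..n}) * (B / n)\<^sup>2) = - ln (2 / \<delta>)"
      using n B ln by (simp add: t_def power_mult_distrib field_simps power2_eq_square)
    \<comment> \<open>The absolute value already sits inside the supremum, so one tail suffices and
      half of \<open>\<delta>\<close> is to spare.\<close>
    also have "exp (- ln (2 / \<delta>)) = \<delta> / 2" using \<delta> by (simp add: exp_minus)
    finally show ?thesis using \<delta> by simp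
  qed
  have "1 - \<delta> \<le> N.prob {z \<in> space N. F z \<le> (\<integral>z. F z \<partial>N) + t}"
    using N.prob_neg[of "\<lambda>z. F z \<le> (\<integral>z. F z \<partial>N) + t"] tail by simp
  also have "\<dots> \<le> N.prob {z \<in> space N. uniform_deviation P n G z
      \<le> 2 * rademacher_complexity P n G + ereal t}"
  proof (rule N.finite_measure_mono_AE)
    show "AE z in N. z \<in> {z \<in> space N. F z \<le> (\<integral>z. F z \<partial>N) + t} \<longrightarrow>
        z \<in> {z \<in> space N. uniform_deviation P n G z \<le> 2 * rademacher_complexity P n G + ereal t}"
      using F_ae
    proof eventually_elim
      case (elim z)
      show ?case
      proof safe
        assume "F z \<le> (\<integral>z. F z \<partial>N) + t"
        then have "ereal (F z) \<le> ereal (\<integral>z. F z \<partial>N) + ereal t" by simp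
        also have "\<dots> \<le> 2 * rademacher_complexity P n G + ereal t" by (intro add_right_mono EF)
        finally show "uniform_deviation P n G z \<le> 2 * rademacher_complexity P n G + ereal t"
          unfolding elim .
      qed
    qed
  qed measurable
  finally show ?thesis unfolding t_def .
qed

end

section \<open>Cross entropy on credal sets\<close>

lemma compact_prob_simplex: "compact (prob_simplex :: (real ^ 'k::finite) set)"
proof -
  have "prob_simplex = (\<Inter>k. {q :: real ^ 'k. 0 \<le> q $ k}) \<inter> {q. (\<Sum>k\<in>UNIV. q $ k) = 1}"
    by (auto simp: prob_simplex_def)
  moreover have "closed \<dots>"
    by (intro closed_Int closed_INT ballI closed_Collect_le closed_Collect_eq continuous_intros)
  moreover have "bounded (prob_simplex :: (real ^ 'k) set)"
  proof (rule boundedI)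
    fix q :: "real ^ 'k" assume q: "q \<in> prob_simplex"
    have "norm q \<le> (\<Sum>k\<in>UNIV. \<bar>q $ k\<bar>)" by (rule norm_le_l1_cart)
    also have "\<dots> = (\<Sum>k\<in>UNIV. q $ k)" using q by (intro sum.cong) (auto simp: prob_simplex_def)
    finally show "norm q \<le> 1" using q by (simp add: prob_simplex_def)
  qed
  ultimately show ?thesis by (simp add: compact_eq_bounded_closed)
qed

lemma simplex_le_1: "q \<in> prob_simplex \<Longrightarrow> q $ k \<le> 1"
  using member_le_sum[of k UNIV "\<lambda>k. q $ k"] by (auto simp: prob_simplex_def)

lemma cross_entropy_pos:
  assumes "\<And>k. p $ k > 0"
  shows "cross_entropy p q = ereal (\<Sum>k\<in>UNIV. q $ k * (- ln (p $ k)))"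
  using assms by (simp add: cross_entropy_def neg_log_def less_imp_neq[THEN not_sym])

text \<open>Some coordinate of a probability vector is nonzero, so the minimum is finite; a zero
  coordinate would then make the maximum, and with it the difference, infinite. This is what brings
  the later estimates back to the real logarithm.\<close>

lemma neg_log_range_finite:
  fixes p :: "real ^ 'k::finite"
  assumes p: "p \<in> prob_simplex"
    and range: "Max (range (\<lambda>k. neg_log (p $ k))) - Min (range (\<lambda>k. neg_log (p $ k))) \<le> ereal L"
  shows "p $ k > 0" "- ln (p $ k) - (- ln (p $ l)) \<le> L"
proof -
  have nn: "0 \<le> p $ k" for k using p by (simp add: prob_simplex_def)
  have "\<exists>k. p $ k \<noteq> 0"
  proof (rule ccontr)
    assume "\<not> ?thesis"
    then show False using p by (simp add: prob_simplex_def)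
  qed
  then obtain k0 where k0: "p $ k0 \<noteq> 0" ..
  let ?M = "Max (range (\<lambda>k. neg_log (p $ k)))" and ?m = "Min (range (\<lambda>k. neg_log (p $ k)))"
  have M: "neg_log (p $ k) \<le> ?M" and m: "?m \<le> neg_log (p $ k)" for k by simp_all
  have "neg_log (p $ k0) < \<infinity>" using k0 by (simp add: neg_log_def)
  with m[of k0] have "?m < \<infinity>" by (rule le_less_trans)
  moreover have "?m \<noteq> - \<infinity>"
  proof -
    have "?m \<in> range (\<lambda>k. neg_log (p $ k))" by (rule Min_in) auto
    then show ?thesis by (auto simp: neg_log_def split: if_splits)
  qed
  ultimately obtain m' where m': "?m = ereal m'" by (cases ?m) auto
  have "?M \<noteq> \<infinity>" using range unfolding m' by (cases ?M) auto
  then have "neg_log (p $ k) \<noteq> \<infinity>" for k using M[of k] by (metis ereal_infty_less_eq(1))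
  then have pos: "p $ k > 0" for k using nn[of k] by (metis neg_log_def order_le_less)
  have nl: "neg_log (p $ k) = ereal (- ln (p $ k))" for k
    using pos[of k] by (simp add: neg_log_def)
  have "?M \<in> range (\<lambda>k. neg_log (p $ k))" by (rule Max_in) auto
  then obtain M' where M': "?M = ereal M'" using nl by fastforce
  show "p $ k > 0" by (rule pos)
  show "- ln (p $ k) - (- ln (p $ l)) \<le> L"
  proof -
    have "- ln (p $ k) \<le> M'" using M[of k] nl[of k] M' by (metis ereal_less_eq(3))
    moreover have "m' \<le> - ln (p $ l)" using m[of l] nl[of l] m' by (metis ereal_less_eq(3))
    moreover have "M' - m' \<le> L" using range M' m' by (metis ereal_minus(1) ereal_less_eq(3))
    ultimately show ?thesis by linarith
  qed
qed

text \<open>The weights \<open>q - r\<close> sum to zero, so \<open>a\<close> may be centred at the middle of its range, where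
  it is at most \<open>L / 2\<close> in absolute value.\<close>

lemma expectation_diff_le_range_mult_tv:
  fixes q r :: "real ^ 'k::finite" and a :: "'k \<Rightarrow> real"
  assumes "(\<Sum>k\<in>UNIV. q $ k) = (\<Sum>k\<in>UNIV. r $ k)" and a: "\<And>k l. a k - a l \<le> L"
  shows "(\<Sum>k\<in>UNIV. q $ k * a k) - (\<Sum>k\<in>UNIV. r $ k * a k)
    \<le> L * ((1 / 2) * (\<Sum>k\<in>UNIV. \<bar>q $ k - r $ k\<bar>))"
proof -
  obtain l where l: "\<And>k. a l \<le> a k"
  proof -
    have "Min (range a) \<in> range a" by (rule Min_in) auto
    then obtain l where "Min (range a) = a l" by blast
    then show ?thesis using that[of l] by (metis Min_le finite finite_imageI rangeI)
  qed
  have "(\<Sum>k\<in>UNIV. (q $ k - r $ k) * (a k - (a l + L / 2)))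
      = (\<Sum>k\<in>UNIV. (q $ k - r $ k) * a k) - (\<Sum>k\<in>UNIV. q $ k - r $ k) * (a l + L / 2)"
    by (simp only: right_diff_distrib sum_subtractf[symmetric] sum_distrib_right)
  moreover have "(\<Sum>k\<in>UNIV. q $ k - r $ k) = 0" using assms(1) by (simp add: sum_subtractf)
  moreover have "(\<Sum>k\<in>UNIV. (q $ k - r $ k) * a k) = (\<Sum>k\<in>UNIV. q $ k * a k) - (\<Sum>k\<in>UNIV. r $ k * a k)"
    by (simp add: left_diff_distrib sum_subtractf)
  ultimately have "(\<Sum>k\<in>UNIV. q $ k * a k) - (\<Sum>k\<in>UNIV. r $ k * a k)
      = (\<Sum>k\<in>UNIV. (q $ k - r $ k) * (a k - (a l + L / 2)))" by simp
  also have "\<dots> \<le> (\<Sum>k\<in>UNIV. \<bar>q $ k - r $ k\<bar> * (L / 2))"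
  proof (rule sum_mono)
    fix k
    have "\<bar>a k - (a l + L / 2)\<bar> \<le> L / 2" using l[of k] a[of k l] by linarith
    then have "\<bar>(q $ k - r $ k) * (a k - (a l + L / 2))\<bar> \<le> \<bar>q $ k - r $ k\<bar> * (L / 2)"
      unfolding abs_mult by (rule mult_left_mono) simp
    then show "(q $ k - r $ k) * (a k - (a l + L / 2)) \<le> \<bar>q $ k - r $ k\<bar> * (L / 2)" by linarith
  qed
  also have "\<dots> = L * ((1 / 2) * (\<Sum>k\<in>UNIV. \<bar>q $ k - r $ k\<bar>))"
    by (simp add: sum_distrib_left algebra_simps)
  finally show ?thesis .
qed

lemma neg_ln_midpoint:
  fixes a b :: real
  assumes "a > 0" "b > 0" shows "- ln ((a + b) / 2) \<le> (- ln a + - ln b) / 2"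
proof -
  have "(ln a + ln b) / 2 = ln (sqrt (a * b))" using assms by (simp add: ln_sqrt ln_mult)
  also have "\<dots> \<le> ln ((a + b) / 2)" using assms arith_geo_mean_sqrt[of a b] by (subst ln_le_cancel_iff) auto
  finally show ?thesis by simp
qed

text \<open>The supremum is taken in the reals, so it is an upper bound only because the set is
  bounded; the bound 1 comes from \<open>\<bar>a - b\<bar> \<le> a + b\<close> for nonnegative
  coordinates.\<close>

lemma tv_upper:
  assumes "Q x \<subseteq> prob_simplex" "q \<in> Q x" "r \<in> Q x"
  shows "(1 / 2) * (\<Sum>k\<in>UNIV. \<bar>q $ k - r $ k\<bar>) \<le> tv_diameter Q x"
    and bdd_above_tv: "bdd_above ((\<lambda>(q, r). (1 / 2) * (\<Sum>k\<in>UNIV. \<bar>q $ k - r $ k\<bar>)) ` (Q x \<times> Q x))"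
    and tv_diameter_le_1: "tv_diameter Q x \<le> 1"
proof -
  have b: "(1 / 2) * (\<Sum>k\<in>UNIV. \<bar>q $ k - r $ k\<bar>) \<le> 1" if "q \<in> Q x" "r \<in> Q x" for q r
  proof -
    have qr: "q \<in> prob_simplex" "r \<in> prob_simplex" using that assms(1) by auto
    then have "(\<Sum>k\<in>UNIV. \<bar>q $ k - r $ k\<bar>) \<le> (\<Sum>k\<in>UNIV. q $ k + r $ k)"
      by (intro sum_mono) (simp add: prob_simplex_def abs_le_iff)
    also have "\<dots> = 2" using qr by (simp add: sum.distrib prob_simplex_def)
    finally show ?thesis by simp
  qed
  show bdd: "bdd_above ((\<lambda>(q, r). (1 / 2) * (\<Sum>k\<in>UNIV. \<bar>q $ k - r $ k\<bar>)) ` (Q x \<times> Q x))"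
    by (rule bdd_aboveI2[of _ _ 1]) (use b in auto)
  show "(1 / 2) * (\<Sum>k\<in>UNIV. \<bar>q $ k - r $ k\<bar>) \<le> tv_diameter Q x"
    unfolding tv_diameter_def using cSUP_upper[OF _ bdd, of "(q, r)"] assms(2,3) by simp
  show "tv_diameter Q x \<le> 1"
    unfolding tv_diameter_def by (rule cSUP_least) (use assms(2) b in auto)
qed

lemma tv_diameter_nonneg:
  assumes "Q x \<subseteq> prob_simplex" "Q x \<noteq> {}" shows "0 \<le> tv_diameter Q x"
proof -
  obtain q where "q \<in> Q x" using assms(2) by blast
  from tv_upper(1)[of Q x q q, OF assms(1) this this] show ?thesis by simp
qed

lemma cross_entropy_nonneg:
  assumes "p \<in> prob_simplex" "q \<in> prob_simplex" shows "0 \<le> cross_entropy p q"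
  unfolding cross_entropy_def
proof (rule sum_nonneg)
  fix k
  have "0 \<le> p $ k" "p $ k \<le> 1" using assms(1) simplex_le_1 by (auto simp: prob_simplex_def)
  then have "0 \<le> neg_log (p $ k)" by (cases "p $ k = 0") (simp_all add: neg_log_def)
  then show "0 \<le> ereal (q $ k) * neg_log (p $ k)" using assms(2) by (simp add: prob_simplex_def)
qed

section \<open>Measurability of the cross entropy, the two-head loss and the diameter\<close>

lemma measurable_cross_entropy:
  fixes f g :: "'c \<Rightarrow> real ^ 'k::finite"
  assumes f: "f \<in> borel_measurable M" and g: "g \<in> borel_measurable M"
  shows "(\<lambda>x. cross_entropy (f x) (g x)) \<in> borel_measurable M"
proof -
  have nth: "(\<lambda>p :: real ^ 'k. p $ k) \<in> borel_measurable borel" for k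
    by (intro borel_measurable_continuous_onI continuous_intros)
  have [measurable]: "(\<lambda>x. f x $ k) \<in> borel_measurable M" "(\<lambda>x. g x $ k) \<in> borel_measurable M" for k
    using measurable_compose[OF f nth] measurable_compose[OF g nth] by auto
  have [measurable]: "neg_log \<in> borel_measurable borel"
    unfolding neg_log_def[abs_def] by measurable
  show ?thesis unfolding cross_entropy_def
    by (intro borel_measurable_ereal_sum borel_measurable_ereal_times) measurable
qed

lemma measurable_two_head_loss:
  fixes Q :: "'a::polish_space \<Rightarrow> (real ^ 'k::finite) set"
  assumes M: "finite_measure M" "sets M = sets borel" and Q: "credal_kernel Q"
    and f: "predictor (fm \<theta>)" "predictor (fp \<theta>)"
  shows "two_head_loss Q fm fp \<theta> \<in> borel_measurable (completion M)"
proof -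
  have Q': "{(x, q). q \<in> Q x} \<in> sets (borel \<Otimes>\<^sub>M borel)" "\<And>x. Q x \<subseteq> prob_simplex"
    using Q by (auto simp: credal_kernel_def)
  have m: "(\<lambda>(x, q). cross_entropy (h x) q) \<in> borel_measurable (borel \<Otimes>\<^sub>M borel)"
    if "predictor h" for h :: "'a \<Rightarrow> real ^ 'k"
    using that unfolding case_prod_unfold predictor_def
    by (intro measurable_cross_entropy measurable_compose[OF measurable_fst] measurable_snd) auto
  show ?thesis unfolding two_head_loss_def[abs_def]
    by (intro borel_measurable_ereal_divide borel_measurable_ereal_add borel_measurable_const
        measurable_completion_SUP[OF M Q' compact_prob_simplex m]
        measurable_completion_INF[OF M Q' compact_prob_simplex m] f)
qed

text \<open>The diameter is a supremum over pairs, so the projection argument runs over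
  \<open>Q x \<times> Q x\<close> inside the square of the simplex. The supremum being real, its
  superlevel sets become existential only once boundedness and nonemptiness are known.\<close>

lemma measurable_tv_diameter:
  fixes Q :: "'a::polish_space \<Rightarrow> (real ^ 'k::finite) set"
  assumes M: "finite_measure M" "sets M = sets borel" and Q: "credal_kernel Q"
  shows "tv_diameter Q \<in> borel_measurable (completion M)"
proof (rule borel_measurableI_greater)
  fix c
  have G: "{(x, q). q \<in> Q x} \<in> sets (borel \<Otimes>\<^sub>M borel)"
    and Qs: "\<And>x. Q x \<subseteq> prob_simplex" "\<And>x. Q x \<noteq> {}"
    using Q by (auto simp: credal_kernel_def)
  let ?d = "\<lambda>p :: (real ^ 'k) \<times> (real ^ 'k). (1 / 2) * (\<Sum>k\<in>UNIV. \<bar>fst p $ k - snd p $ k\<bar>)"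
  have "(\<lambda>p. (fst p, fst (snd p))) \<in> measurable (borel \<Otimes>\<^sub>M (borel \<Otimes>\<^sub>M borel)) (borel \<Otimes>\<^sub>M borel)"
    and "(\<lambda>p. (fst p, snd (snd p))) \<in> measurable (borel \<Otimes>\<^sub>M (borel \<Otimes>\<^sub>M borel)) (borel \<Otimes>\<^sub>M borel)"
    by measurable
  from sets.Int[OF measurable_sets[OF this(1) G] measurable_sets[OF this(2) G]]
  have "{(x, p). p \<in> Q x \<times> Q x} \<in> sets (borel \<Otimes>\<^sub>M (borel \<Otimes>\<^sub>M borel))"
    by (simp add: space_pair_measure vimage_def Int_def case_prod_unfold mem_Times_iff)
  then have 1: "{(x, p). p \<in> Q x \<times> Q x} \<in> sets (borel \<Otimes>\<^sub>M borel)"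
    unfolding borel_prod .
  have "?d \<in> borel_measurable borel"
    by (intro borel_measurable_continuous_onI continuous_intros)
  then have "{p \<in> space (borel \<Otimes>\<^sub>M borel). c < ?d (snd p)} \<in> sets (borel \<Otimes>\<^sub>M borel)"
    by measurable
  then have 2: "{(x :: 'a, p). c < ?d p} \<in> sets (borel \<Otimes>\<^sub>M borel)"
    by (simp add: space_pair_measure case_prod_unfold)
  have "{x. \<exists>p\<in>Q x \<times> Q x. c < ?d p} \<in> sets (completion M)"
    by (rule sets_completion_Bex[OF M 1 _ compact_Times[OF compact_prob_simplex compact_prob_simplex] 2])
       (use Qs in blast)
  moreover have "c < tv_diameter Q x \<longleftrightarrow> (\<exists>p\<in>Q x \<times> Q x. c < ?d p)" for x
  proof -
    obtain q where "q \<in> Q x" using Qs(2) by blast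
    from bdd_above_tv[of Q x q q, OF Qs(1) this this] Qs(2)[of x] show ?thesis
      unfolding tv_diameter_def by (subst less_cSUP_iff) (auto simp: case_prod_unfold)
  qed
  ultimately show "{x \<in> space (completion M). c < tv_diameter Q x} \<in> sets (completion M)"
    using sets_eq_imp_space_eq[OF M(2)] by simp
qed

section \<open>From pointwise comparison of losses to risks\<close>

lemma expect_add_le:
  assumes j: "j \<in> borel_measurable (completion M)" and t: "t \<in> borel_measurable (completion M)"
    and ae: "AE x in M. 0 \<le> j x \<and> 0 \<le> t x \<and> u x \<le> j x + ereal (c * t x)" and c: "0 \<le> c"
  shows "expect M u \<le> expect M j + ereal c * expect M (\<lambda>x. ereal (t x))"
proof -
  have "(\<integral>\<^sup>+ x. e2ennreal (u x) \<partial>M) \<le> (\<integral>\<^sup>+ x. e2ennreal (j x) + ennreal c * ennreal (t x) \<partial>M)"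
  proof (rule nn_integral_mono_AE)
    show "AE x in M. e2ennreal (u x) \<le> e2ennreal (j x) + ennreal c * ennreal (t x)"
      using ae
    proof eventually_elim
      case (elim x)
      then have "e2ennreal (u x) \<le> e2ennreal (j x + ereal (c * t x))" by (intro e2ennreal_mono) simp
      also have "\<dots> = e2ennreal (j x) + ennreal c * ennreal (t x)"
        using elim c by (simp add: e2ennreal_add ennreal_mult)
      finally show ?case .
    qed
  qed
  \<comment> \<open>Splitting the sum asks for measurable summands, and \<open>j\<close> and
    \<open>t\<close> are known to be measurable for the completion; the value of the integral is the
    same there.\<close>
  also have "\<dots> = (\<integral>\<^sup>+ x. e2ennreal (j x) + ennreal c * ennreal (t x) \<partial>completion M)"
    by (rule nn_integral_completion[symmetric])
  also have "\<dots> = (\<integral>\<^sup>+ x. e2ennreal (j x) \<partial>completion M) + ennreal c * (\<integral>\<^sup>+ x. ennreal (t x) \<partial>completion M)"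
    using measurable_compose[OF j measurable_e2ennreal] measurable_compose[OF t measurable_ennreal]
    by (subst nn_integral_add) (auto simp: nn_integral_cmult)
  finally have "(\<integral>\<^sup>+ x. e2ennreal (u x) \<partial>M)
      \<le> (\<integral>\<^sup>+ x. e2ennreal (j x) \<partial>M) + ennreal c * (\<integral>\<^sup>+ x. ennreal (t x) \<partial>M)"
    by (simp add: nn_integral_completion)
  then show ?thesis using c
    by (simp add: expect_def less_eq_ennreal.rep_eq plus_ennreal.rep_eq times_ennreal.rep_eq enn2ereal_ennreal)
qed

text \<open>Let \<open>d\<close> be the diameter. As \<open>p0\<close> is in \<open>Q x\<close>, the
  maximum lies between the loss of its head at \<open>p0\<close> and \<open>L * d\<close> above it,
  the minimum between \<open>L * d\<close> below the loss of its head at \<open>p0\<close> and that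
  loss. The first claim uses the lower estimates, the second the upper ones; each time one summand
  is free of error, and halving leaves \<open>L / 2\<close>.\<close>

lemma two_head_loss_risk_bounds:
  fixes fm fp :: "'p \<Rightarrow> 'a \<Rightarrow> real ^ 'k::finite"
  assumes Q: "Q x \<subseteq> prob_simplex" and p0: "p0 \<in> Q x"
    and simplex: "\<And>f. f \<in> {fm \<theta>, fp \<theta>} \<Longrightarrow> f x \<in> prob_simplex"
    and bounded: "\<And>f q. f \<in> {fm \<theta>, fp \<theta>} \<Longrightarrow> q \<in> Q x \<Longrightarrow>
        0 \<le> cross_entropy (f x) q \<and> cross_entropy (f x) q \<le> ereal B"
    and log_range: "\<And>f. f \<in> {fm \<theta>, fp \<theta>} \<Longrightarrow>
        Max (range (\<lambda>k. neg_log (f x $ k))) - Min (range (\<lambda>k. neg_log (f x $ k))) \<le> ereal L"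
  shows "cross_entropy (mean_head fm fp \<theta> x) p0 \<le> two_head_loss Q fm fp \<theta> x + ereal (L / 2 * tv_diameter Q x)"
    and "fm \<theta> = fp \<theta> \<Longrightarrow>
      two_head_loss Q fm fp \<theta> x \<le> cross_entropy (fp \<theta> x) p0 + ereal (L / 2 * tv_diameter Q x)"
    and "0 \<le> two_head_loss Q fm fp \<theta> x" "two_head_loss Q fm fp \<theta> x \<le> ereal B" "0 \<le> L"
proof -
  let ?d = "tv_diameter Q x"
  let ?c = "\<lambda>p q. \<Sum>k\<in>UNIV. q $ k * (- ln (p $ k :: real))"
  have pos: "f x $ k > 0" and rng: "- ln (f x $ k) - (- ln (f x $ l)) \<le> L"
    if "f \<in> {fm \<theta>, fp \<theta>}" for f k l
    using neg_log_range_finite[OF simplex[OF that] log_range[OF that]] by auto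
  show L: "0 \<le> L" using rng[of "fm \<theta>" undefined undefined] by simp
  have ce: "cross_entropy (f x) q = ereal (?c (f x) q)" if "f \<in> {fm \<theta>, fp \<theta>}" for f q
    by (rule cross_entropy_pos) (rule pos[OF that])
  have lip: "?c (f x) q - ?c (f x) r \<le> L * ?d" if f: "f \<in> {fm \<theta>, fp \<theta>}" and q: "q \<in> Q x" "r \<in> Q x" for f q r
  proof -
    have "?c (f x) q - ?c (f x) r \<le> L * ((1 / 2) * (\<Sum>k\<in>UNIV. \<bar>q $ k - r $ k\<bar>))"
      by (rule expectation_diff_le_range_mult_tv)
         (use Q q rng[OF f] in \<open>auto simp: prob_simplex_def subset_iff\<close>)
    also have "\<dots> \<le> L * ?d" by (intro mult_left_mono tv_upper Q q L)
    finally show ?thesis .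
  qed
  define S where "S = (SUP q\<in>Q x. cross_entropy (fm \<theta> x) q)"
  define I where "I = (INF q\<in>Q x. cross_entropy (fp \<theta> x) q)"
  have S: "ereal (?c (fm \<theta> x) p0) \<le> S" "S \<le> ereal (?c (fm \<theta> x) p0 + L * ?d)" "S \<le> ereal B"
  proof -
    show "ereal (?c (fm \<theta> x) p0) \<le> S" unfolding S_def by (rule SUP_upper2[OF p0]) (simp add: ce)
    show "S \<le> ereal (?c (fm \<theta> x) p0 + L * ?d)" unfolding S_def
    proof (rule SUP_least)
      fix q assume "q \<in> Q x"
      from lip[of "fm \<theta>", OF _ this p0] show "cross_entropy (fm \<theta> x) q \<le> ereal (?c (fm \<theta> x) p0 + L * ?d)"
        using ce[of "fm \<theta>" q] by simp
    qed
    show "S \<le> ereal B" unfolding S_def by (rule SUP_least) (use bounded in auto)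
  qed
  have I: "ereal (?c (fp \<theta> x) p0 - L * ?d) \<le> I" "I \<le> ereal (?c (fp \<theta> x) p0)" "0 \<le> I" "I \<le> ereal B"
  proof -
    show "I \<le> ereal (?c (fp \<theta> x) p0)" unfolding I_def by (rule INF_lower2[OF p0]) (simp add: ce)
    show "ereal (?c (fp \<theta> x) p0 - L * ?d) \<le> I" unfolding I_def
    proof (rule INF_greatest)
      fix q assume "q \<in> Q x"
      from lip[of "fp \<theta>", OF _ p0 this] show "ereal (?c (fp \<theta> x) p0 - L * ?d) \<le> cross_entropy (fp \<theta> x) q"
        using ce[of "fp \<theta>" q] by simp
    qed
    show "0 \<le> I" unfolding I_def by (rule INF_greatest) (use bounded in auto)
    show "I \<le> ereal B" unfolding I_def by (rule INF_lower2[OF p0]) (use bounded p0 in auto)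
  qed
  have "0 \<le> ?c (fm \<theta> x) p0" using bounded[of "fm \<theta>" p0] p0 by (simp add: ce)
  then have "0 \<le> S" using S(1) by (meson ereal_less_eq(5) order_trans)
  obtain s where s: "S = ereal s" using S by (cases S) auto
  obtain i where i: "I = ereal i" using I by (cases I) auto
  have j: "two_head_loss Q fm fp \<theta> x = ereal ((s + i) / 2)"
    unfolding two_head_loss_def S_def[symmetric] I_def[symmetric] s i by simp
  show "0 \<le> two_head_loss Q fm fp \<theta> x" "two_head_loss Q fm fp \<theta> x \<le> ereal B"
    using \<open>0 \<le> S\<close> S(3) I(3,4) unfolding j s i by auto
  show "two_head_loss Q fm fp \<theta> x \<le> cross_entropy (fp \<theta> x) p0 + ereal (L / 2 * ?d)" if "fm \<theta> = fp \<theta>"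
    using S(2) I(2) that unfolding j s i by (simp add: ce field_simps)
  have mpos: "mean_head fm fp \<theta> x $ k = (fm \<theta> x $ k + fp \<theta> x $ k) / 2" for k
    by (simp add: mean_head_def)
  have "?c (mean_head fm fp \<theta> x) p0 \<le> (\<Sum>k\<in>UNIV. p0 $ k * ((- ln (fm \<theta> x $ k) + - ln (fp \<theta> x $ k)) / 2))"
    unfolding mpos using Q p0 pos
    by (intro sum_mono mult_left_mono neg_ln_midpoint) (auto simp: prob_simplex_def subset_iff)
  also have "\<dots> = (?c (fm \<theta> x) p0 + ?c (fp \<theta> x) p0) / 2"
    by (simp add: sum.distrib[symmetric] sum_divide_distrib algebra_simps)
  also have "\<dots> \<le> (s + i) / 2 + L / 2 * ?d" using S(1) I(1) unfolding s i by (simp add: field_simps)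
  finally have "?c (mean_head fm fp \<theta> x) p0 \<le> (s + i) / 2 + L / 2 * ?d" .
  moreover have "mean_head fm fp \<theta> x $ k > 0" for k
    unfolding mpos using pos[of "fm \<theta>" k] pos[of "fp \<theta>" k] by simp
  ultimately show "cross_entropy (mean_head fm fp \<theta> x) p0
      \<le> two_head_loss Q fm fp \<theta> x + ereal (L / 2 * ?d)"
    unfolding j by (subst cross_entropy_pos) simp_all
qed

section \<open>Excess risk of near-minimizers of the empirical objective\<close>

theorem theorem1:
  fixes P0 :: "('a::polish_space \<times> 'k::finite) measure"
    and p0 :: "'a \<Rightarrow> real ^ 'k"
    and Q :: "'a \<Rightarrow> (real ^ 'k) set"
    and \<Theta> :: "'p set"
    and fm fp :: "'p \<Rightarrow> 'a \<Rightarrow> real ^ 'k"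
    and B L \<eta> \<delta> :: real
    and X0 :: "'a set"
    and n :: nat
    and M :: "'w measure"
    and X :: "nat \<Rightarrow> 'w \<Rightarrow> 'a"
    and \<theta>hat :: "(nat \<Rightarrow> 'a) \<Rightarrow> 'p"
  defines "PX \<equiv> input_marginal P0"
    and "sample \<equiv> (\<lambda>\<omega>. \<lambda>i\<in>{1..n}. X i \<omega>)"
  assumes P0: "prob_space P0" "sets P0 = sets (borel \<Otimes>\<^sub>M count_space UNIV)"
    and p0: "cond_label_dist P0 p0"
    and Q: "credal_kernel Q"
    and coverage: "AE x in PX. p0 x \<in> Q x"
    and heads: "\<And>\<theta>. \<theta> \<in> \<Theta> \<Longrightarrow> predictor (fm \<theta>)" "\<And>\<theta>. \<theta> \<in> \<Theta> \<Longrightarrow> predictor (fp \<theta>)"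
    and nonempty: "diagonal_class \<Theta> fm fp \<noteq> {}"
    and X0: "X0 \<in> sets borel" "measure PX X0 = 1"
    and bounded: "\<And>x \<theta> f q. x \<in> X0 \<Longrightarrow> \<theta> \<in> \<Theta> \<Longrightarrow> f \<in> {fm \<theta>, fp \<theta>} \<Longrightarrow> q \<in> Q x \<Longrightarrow>
        0 \<le> cross_entropy (f x) q \<and> cross_entropy (f x) q \<le> ereal B"
    and log_range: "\<And>x \<theta> f. x \<in> X0 \<Longrightarrow> \<theta> \<in> \<Theta> \<Longrightarrow> f \<in> {fm \<theta>, fp \<theta>} \<Longrightarrow>
        Max (range (\<lambda>k. neg_log (f x $ k))) - Min (range (\<lambda>k. neg_log (f x $ k))) \<le> ereal L"
    and n: "n \<ge> 1"
    and meas_deviation: "uniform_deviation PX n (loss_class Q \<Theta> fm fp)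
        \<in> borel_measurable (\<Pi>\<^sub>M i\<in>{1..n}. PX)"
    and meas_rademacher: "rademacher_sup n (loss_class Q \<Theta> fm fp)
        \<in> borel_measurable (rademacher_space PX n)"
    and M: "prob_space M"
    and indep: "prob_space.indep_vars M (\<lambda>i. borel) X {1..n}"
    and law: "\<And>i. i \<in> {1..n} \<Longrightarrow> distr M borel (X i) = PX"
    and \<eta>: "\<eta> \<ge> 0"
    and \<theta>hat: "\<And>\<omega>. \<omega> \<in> space M \<Longrightarrow> \<theta>hat (sample \<omega>) \<in> \<Theta>"
    and near_min: "AE \<omega> in M. empirical_objective Q fm fp n (sample \<omega>) (\<theta>hat (sample \<omega>))
        \<le> (INF \<theta>\<in>\<Theta>. empirical_objective Q fm fp n (sample \<omega>) \<theta>) + ereal \<eta>"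
    and \<delta>: "0 < \<delta>" "\<delta> < 1"
  shows "\<exists>E\<in>sets M. measure M E \<ge> 1 - \<delta> \<and>
    (\<forall>\<omega>\<in>E. true_risk P0 p0 (mean_head fm fp (\<theta>hat (sample \<omega>)))
              - (INF f\<in>diagonal_class \<Theta> fm fp. true_risk P0 p0 f)
            \<le> 4 * rademacher_complexity PX n (loss_class Q \<Theta> fm fp)
              + ereal (2 * B * sqrt (ln (2 / \<delta>) / (2 * real n))) + ereal \<eta>
              + ereal L * expect PX (\<lambda>x. ereal (tv_diameter Q x)))"
proof -
  have fst: "fst \<in> measurable P0 borel"
    using measurable_cong_sets[OF P0(2) refl] by (metis measurable_fst)
  have PX_sets: "sets PX = sets borel" by (simp add: PX_def input_marginal_def)
  have PX_prob: "prob_space PX"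
    unfolding PX_def input_marginal_def by (rule prob_space.prob_space_distr[OF P0(1) fst])
  interpret M: prob_space M by fact
  interpret PX: prob_space PX by fact
  note PX_fin = PX.finite_measure_axioms
  let ?G = "loss_class Q \<Theta> fm fp" and ?j = "two_head_loss Q fm fp"
  have Qx: "Q x \<subseteq> prob_simplex" "Q x \<noteq> {}" for x using Q by (auto simp: credal_kernel_def)
  have d_nonneg: "0 \<le> tv_diameter Q x" for x by (rule tv_diameter_nonneg) (rule Qx)+
  have p0s: "p0 x \<in> prob_simplex" for x using p0 by (simp add: cond_label_dist_def)
  have simplex: "f x \<in> prob_simplex" if "\<theta> \<in> \<Theta>" "f \<in> {fm \<theta>, fp \<theta>}" for \<theta> f x
    using heads that by (auto simp: predictor_def)
  have pointwise:
    "cross_entropy (mean_head fm fp \<theta> x) q \<le> ?j \<theta> x + ereal (L / 2 * tv_diameter Q x)"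
    "fm \<theta> = fp \<theta> \<Longrightarrow> ?j \<theta> x \<le> cross_entropy (fp \<theta> x) q + ereal (L / 2 * tv_diameter Q x)"
    "0 \<le> ?j \<theta> x" "?j \<theta> x \<le> ereal B" "0 \<le> L"
    if "x \<in> X0" "\<theta> \<in> \<Theta>" "q \<in> Q x" for x \<theta> q
  proof -
    note in_sets = that
    note bounds = two_head_loss_risk_bounds[where Q = Q and x = x and ?p0.0 = q
        and fm = fm and fp = fp and \<theta> = \<theta> and B = B and L = L]
    show "cross_entropy (mean_head fm fp \<theta> x) q \<le> ?j \<theta> x + ereal (L / 2 * tv_diameter Q x)"
      by (rule bounds(1)) (use Qx in_sets simplex bounded log_range in blast)+
    show "?j \<theta> x \<le> cross_entropy (fp \<theta> x) q + ereal (L / 2 * tv_diameter Q x)" if "fm \<theta> = fp \<theta>"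
      by (rule bounds(2)[OF _ _ _ _ _ that]) (use Qx in_sets simplex bounded log_range in blast)+
    show "0 \<le> ?j \<theta> x"
      by (rule bounds(3)) (use Qx in_sets simplex bounded log_range in blast)+
    show "?j \<theta> x \<le> ereal B"
      by (rule bounds(4)) (use Qx in_sets simplex bounded log_range in blast)+
    show "0 \<le> L"
      by (rule bounds(5)) (use Qx in_sets simplex bounded log_range in blast)+
  qed
  have X0_AE: "AE x in PX. x \<in> X0"
    using X0 PX.prob_eq_1[of X0] PX_sets by simp
  have j_bounds: "0 \<le> ?j \<theta> x \<and> ?j \<theta> x \<le> ereal B \<and> 0 \<le> L" if "x \<in> X0" "\<theta> \<in> \<Theta>" for \<theta> x
  proof -
    obtain q where "q \<in> Q x" using Qx(2) by blast
    from pointwise(3-5)[OF that this] show ?thesis by blast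
  qed
  have j_meas: "?j \<theta> \<in> borel_measurable (completion PX)" if "\<theta> \<in> \<Theta>" for \<theta>
    by (rule measurable_two_head_loss[where fm = fm and fp = fp and \<theta> = \<theta>, OF PX_fin PX_sets Q heads[OF that]])
  have d_meas: "tv_diameter Q \<in> borel_measurable (completion PX)"
    by (rule measurable_tv_diameter[OF PX_fin PX_sets Q])
  obtain \<theta>0 where \<theta>0: "\<theta>0 \<in> \<Theta>" using nonempty by (auto simp: diagonal_class_def)
  interpret C: bounded_class PX X0 B n ?G
  proof
    show "X0 \<in> sets PX" "PX.prob X0 = 1" "n \<ge> 1" using X0 PX_sets n by auto
    show "?G \<noteq> {}" using \<theta>0 by (auto simp: loss_class_def)
  qed (use j_bounds j_meas in \<open>auto simp: loss_class_def\<close>)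
  obtain x0 where "x0 \<in> X0" using C.X0_nonempty by blast
  then have L: "0 \<le> L" using j_bounds \<theta>0 by blast
  define t where "t = B * sqrt (ln (2 / \<delta>) / (2 * real n))"
  define A where "A = {z \<in> space C.N. uniform_deviation PX n ?G z \<le> 2 * rademacher_complexity PX n ?G + ereal t}"
  have A: "A \<in> sets C.N" "1 - \<delta> \<le> C.N.prob A"
    using C.uniform_deviation_concentration[OF meas_deviation meas_rademacher \<delta>] meas_deviation
    unfolding A_def t_def by simp_all

  have X_meas: "X i \<in> measurable M borel" if "i \<in> {1..n}" for i
    using indep that unfolding M.indep_vars_def by blast
  have N_sets: "sets (\<Pi>\<^sub>M i\<in>{1..n}. borel) = sets C.N"
    by (intro sets_PiM_cong) (simp_all add: PX_sets)
  have sample_meas: "sample \<in> measurable M (\<Pi>\<^sub>M i\<in>{1..n}. borel)"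
    unfolding sample_def by (rule measurable_restrict) (rule X_meas)
  \<comment> \<open>The sigma-algebra of \<open>PX\<close> is the Borel one only by a proved
    equation, so the target space is exchanged before independence identifies the joint law with the
    product of the marginals.\<close>
  have "distr M C.N sample = distr M (\<Pi>\<^sub>M i\<in>{1..n}. borel) sample"
    by (rule distr_cong) (simp_all add: N_sets)
  also have "\<dots> = (\<Pi>\<^sub>M i\<in>{1..n}. distr M borel (X i))"
    unfolding sample_def using M.indep_vars_iff_distr_eq_PiM'[of "{1..n}" X "\<lambda>_. borel"] indep n X_meas by simp
  also have "\<dots> = C.N" by (rule PiM_cong) (simp_all add: law)
  finally have sample_law: "distr M C.N sample = C.N" .
  have sample_meas': "sample \<in> measurable M C.N"
    using sample_meas measurable_cong_sets[OF refl N_sets] by blast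

  obtain Z where near: "\<And>\<omega>. \<omega> \<in> space M - Z \<Longrightarrow>
      empirical_objective Q fm fp n (sample \<omega>) (\<theta>hat (sample \<omega>))
        \<le> (INF \<theta>\<in>\<Theta>. empirical_objective Q fm fp n (sample \<omega>) \<theta>) + ereal \<eta>"
    and Z: "Z \<in> null_sets M"
    using AE_E3[OF near_min] by metis
  \<comment> \<open>Near-minimality holds almost everywhere; removing the null set \<open>Z\<close>
    makes it available at every point of \<open>E\<close> without loss of probability.\<close>
  define E where "E = (sample -` A \<inter> space M) - Z"
  have E1: "sample -` A \<inter> space M \<in> sets M" by (rule measurable_sets[OF sample_meas' A(1)])
  have "M.prob E = M.prob (sample -` A \<inter> space M)"
    unfolding E_def by (rule measure_Diff_null_set[OF E1 Z])
  also have "\<dots> = measure (distr M C.N sample) A" by (rule measure_distr[symmetric, OF sample_meas' A(1)])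
  finally have prob_E: "1 - \<delta> \<le> M.prob E" using A(2) unfolding sample_law by simp
  have E_sets: "E \<in> sets M" unfolding E_def using E1 Z by blast

  let ?R = "true_risk P0 p0"
  \<comment> \<open>The diameter is at most 1, so its expectation is a real number and the final
    comparison can be carried out in the reals.\<close>
  obtain d where d: "expect PX (\<lambda>x. ereal (tv_diameter Q x)) = ereal d" "0 \<le> d"
  proof -
    have "(\<integral>\<^sup>+ x. e2ennreal (ereal (tv_diameter Q x)) \<partial>PX) \<le> (\<integral>\<^sup>+ x. 1 \<partial>PX)"
      using Qx by (intro nn_integral_mono) (metis tv_diameter_le_1 e2ennreal_ereal ennreal_le_1 ex_in_conv)
    also have "\<dots> = 1" by (simp add: PX.emeasure_space_1)
    finally have "(\<integral>\<^sup>+ x. e2ennreal (ereal (tv_diameter Q x)) \<partial>PX) < top"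
      using ennreal_one_less_top le_less_trans by blast
    then show ?thesis using that unfolding expect_def
      by (cases "\<integral>\<^sup>+ x. e2ennreal (ereal (tv_diameter Q x)) \<partial>PX") (auto simp: enn2ereal_ennreal)
  qed
  have j_ae: "AE x in PX. x \<in> X0 \<and> p0 x \<in> Q x" using X0_AE coverage by eventually_elim simp
  have mean_risk: "?R (mean_head fm fp \<theta>) \<le> expect PX (?j \<theta>) + ereal (L / 2 * d)" if \<theta>: "\<theta> \<in> \<Theta>" for \<theta>
  proof -
    have "?R (mean_head fm fp \<theta>) \<le> expect PX (?j \<theta>) + ereal (L / 2) * expect PX (\<lambda>x. ereal (tv_diameter Q x))"
      unfolding true_risk_def PX_def[symmetric]
    proof (rule expect_add_le[OF j_meas[OF \<theta>] d_meas])
      show "AE x in PX. 0 \<le> ?j \<theta> x \<and> 0 \<le> tv_diameter Q x \<and>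
          cross_entropy (mean_head fm fp \<theta> x) (p0 x) \<le> ?j \<theta> x + ereal (L / 2 * tv_diameter Q x)"
        using j_ae
      proof eventually_elim
        case (elim x)
        then show ?case
          using pointwise(1)[of x \<theta> "p0 x"] j_bounds[of x \<theta>] d_nonneg[of x] \<theta> by blast
      qed
    qed (use L in simp)
    then show ?thesis by (simp add: d)
  qed
  have diag_risk: "expect PX (?j \<theta>) \<le> ?R (fp \<theta>) + ereal (L / 2 * d)" if \<theta>: "\<theta> \<in> \<Theta>" "fm \<theta> = fp \<theta>" for \<theta>
  proof -
    \<comment> \<open>Compared with \<open>mean_risk\<close> the roles are exchanged: the cross
      entropy is now a summand of the upper bound, so its measurability is due.\<close>
    have ce: "(\<lambda>x. cross_entropy (fp \<theta> x) (p0 x)) \<in> borel_measurable (completion PX)"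
    proof (rule measurable_completion)
      have "(\<lambda>x. cross_entropy (fp \<theta> x) (p0 x)) \<in> borel_measurable borel"
        using heads(2)[OF \<theta>(1)] p0 by (intro measurable_cross_entropy) (auto simp: predictor_def cond_label_dist_def)
      then show "(\<lambda>x. cross_entropy (fp \<theta> x) (p0 x)) \<in> borel_measurable PX"
        using measurable_cong_sets[OF PX_sets refl] by blast
    qed
    have "expect PX (?j \<theta>) \<le> ?R (fp \<theta>) + ereal (L / 2) * expect PX (\<lambda>x. ereal (tv_diameter Q x))"
      unfolding true_risk_def PX_def[symmetric]
    proof (rule expect_add_le[OF ce d_meas])
      show "AE x in PX. 0 \<le> cross_entropy (fp \<theta> x) (p0 x) \<and> 0 \<le> tv_diameter Q x \<and>
          ?j \<theta> x \<le> cross_entropy (fp \<theta> x) (p0 x) + ereal (L / 2 * tv_diameter Q x)"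
        using j_ae
      proof eventually_elim
        case (elim x)
        then show ?case
          using pointwise(2)[of x \<theta> "p0 x"] cross_entropy_nonneg[OF simplex[OF \<theta>(1)] p0s]
            d_nonneg[of x] \<theta> by blast
      qed
    qed (use L in simp)
    then show ?thesis by (simp add: d)
  qed

  show ?thesis
  proof (intro bexI[OF _ E_sets] conjI ballI prob_E)
    fix \<omega> assume \<omega>: "\<omega> \<in> E"
    let ?z = "sample \<omega>" and ?th = "\<theta>hat (sample \<omega>)"
    have th: "?th \<in> \<Theta>" using \<omega> \<theta>hat by (simp add: E_def)
    let ?rhs = "4 * rademacher_complexity PX n ?G + ereal (2 * B * sqrt (ln (2 / \<delta>) / (2 * real n))) + ereal \<eta>
        + ereal L * expect PX (\<lambda>x. ereal (tv_diameter Q x))"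
    have "0 \<le> rademacher_complexity PX n ?G"
      unfolding rademacher_complexity_def expect_def by (rule enn2ereal_nonneg)
    \<comment> \<open>An infinite complexity makes the right-hand side infinite, the other terms
      being real; otherwise everything reduces to real arithmetic.\<close>
    then consider (inf) "rademacher_complexity PX n ?G = \<infinity>"
      | (fin) c where "rademacher_complexity PX n ?G = ereal c"
      by (cases "rademacher_complexity PX n ?G") auto
    then show "?R (mean_head fm fp ?th) - (INF f\<in>diagonal_class \<Theta> fm fp. ?R f) \<le> ?rhs"
    proof cases
      case inf
      then have rhs: "?rhs = \<infinity>" by (simp add: d)
      show ?thesis unfolding rhs by simp
    next
      case fin
      \<comment> \<open>Twice the deviation bound \<open>2 * c + t\<close>, plus
        \<open>\<eta>\<close> and the two halves of \<open>L * d\<close>.\<close>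
      define K where "K = 4 * c + 2 * t + \<eta> + L * d"
      have rhs: "?rhs = ereal K"
        by (simp add: fin d K_def t_def numeral_eq_ereal)
      have dev: "\<exists>e m. expect PX (?j \<theta>) = ereal e \<and> empirical_objective Q fm fp n ?z \<theta> = ereal m
          \<and> \<bar>m - e\<bar> \<le> 2 * c + t" if \<theta>: "\<theta> \<in> \<Theta>" for \<theta>
      proof -
        have jG: "?j \<theta> \<in> ?G" using \<theta> by (auto simp: loss_class_def)
        obtain e where e: "expect PX (?j \<theta>) = ereal e" using C.expect_bounds[OF jG] by blast
        have "\<bar>empirical_mean n (?j \<theta>) ?z - expect PX (?j \<theta>)\<bar> \<le> uniform_deviation PX n ?G ?z"
          unfolding uniform_deviation_def by (rule SUP_upper[OF jG])
        also have "\<dots> \<le> ereal (2 * c + t)"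
          using \<omega> by (simp add: E_def A_def fin numeral_eq_ereal)
        finally show ?thesis
          unfolding empirical_objective_def e by (cases "empirical_mean n (?j \<theta>) ?z") auto
      qed
      obtain e m where em: "expect PX (?j ?th) = ereal e" "empirical_objective Q fm fp n ?z ?th = ereal m"
          "\<bar>m - e\<bar> \<le> 2 * c + t" using dev[OF th] by blast
      have "0 \<le> ?R (mean_head fm fp ?th)" unfolding true_risk_def expect_def by (rule enn2ereal_nonneg)
      with mean_risk[OF th] obtain \<rho> where \<rho>: "?R (mean_head fm fp ?th) = ereal \<rho>" "\<rho> \<le> e + L / 2 * d"
        by (cases "?R (mean_head fm fp ?th)") (auto simp: em)
      \<comment> \<open>With \<open>K\<close> on the other side the claim is a lower bound for each
        comparison risk, finite or not; subtracting the infimum is left to the very end.\<close>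
      have "ereal (\<rho> - K) \<le> (INF f\<in>diagonal_class \<Theta> fm fp. ?R f)"
      proof (rule INF_greatest)
        fix f assume "f \<in> diagonal_class \<Theta> fm fp"
        then obtain \<theta> where \<theta>: "\<theta> \<in> \<Theta>" "fm \<theta> = f" "fp \<theta> = f" by (auto simp: diagonal_class_def)
        obtain e' m' where em': "expect PX (?j \<theta>) = ereal e'" "empirical_objective Q fm fp n ?z \<theta> = ereal m'"
            "\<bar>m' - e'\<bar> \<le> 2 * c + t" using dev[OF \<theta>(1)] by blast
        have "ereal m \<le> (INF \<theta>\<in>\<Theta>. empirical_objective Q fm fp n ?z \<theta>) + ereal \<eta>"
          unfolding em(2)[symmetric] using \<omega> by (intro near) (simp add: E_def)
        also have "\<dots> \<le> ereal m' + ereal \<eta>"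
          unfolding em'(2)[symmetric] by (intro add_right_mono INF_lower \<theta>)
        finally have "m \<le> m' + \<eta>" by simp
        moreover have "ereal e' \<le> ?R f + ereal (L / 2 * d)"
          using diag_risk[of \<theta>] \<theta> em'(1) by simp
        ultimately show "ereal (\<rho> - K) \<le> ?R f"
          using \<rho>(2) em(3) em'(3) unfolding K_def by (cases "?R f") auto
      qed
      then show ?thesis unfolding rhs \<rho>(1)
        by (cases "INF f\<in>diagonal_class \<Theta> fm fp. ?R f") auto
    qed
  qed
qed

end
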